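(* Let $\mathcal C$ be an exact Goursat category, $\mathcal L$ a Birkhoff subcategory of $\mathcal C$, and $\overline{(\,\,)}$ the corresponding Birkhoff closure operator on equivalence relations. Then, for any object $X$ of $\mathcal C$ and any equivalence relation $S$ on $X$, one has $$\overline{S}=\overline{\Delta_X}\circ S\circ\overline{\Delta_X}=S\circ\overline{\Delta_X}\circ S,$$ where $\Delta_X$ is the discrete equivalence relation on $X$.
   Context: An exact category is a finitely complete regular category in which every equivalence relation is effective, i.e. is a kernel pair. An exact Goursat category is an exact category in which any two equivalence relations $R,S$ on the same object satisfy $R\circ S\circ R=S\circ R\circ S$, where $\circ$ is relational composition. An epireflective subcategory $\mathcal L$ of $\mathcal C$ is a full replete reflective subcategory, with inclusion $\iota$ and left adjoint $\lambda$, such that every component $\eta_A\colon A\to\iota\lambda(A)$ of the unit is a regular epimorphism. It is a Birkhoff subcategory if it is closed under regular quotients: if $f\colon X\to Y$ is a regular epimorphism and $X\in\mathcal L$, then $Y\in\mathcal L$. The closure operator corresponding to $\mathcal L$ sends an equivalence relation $S$ on $X$, with quotient $q\colon X\to X/S$ (the coequaliser of the projections of $S$), to the kernel pair $\overline S$ of the composite $\eta_{X/S}\circ q\colon X\to\iota\lambda(X/S)$. In particular $\overline{\Delta_X}$ is the kernel pair of $\eta_X$, where $\Delta_X$ is the diagonal relation on $X$. Relations on $X$ are regarded as subobjects of $X\times X$, and equality is that of subobjects. *)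

theory Defs
  imports Main
begin

section \<open>Categories, functors, limits\<close>

record ('o, 'm) cat =
  Obj :: "'o set"
  Arr :: "'m set"
  Dom :: "'m \<Rightarrow> 'o"
  Cod :: "'m \<Rightarrow> 'o"
  Ident :: "'o \<Rightarrow> 'm"
  Comp :: "'m \<Rightarrow> 'm \<Rightarrow> 'm"  (infixr "\<cdot>\<index>" 70)

definition hom :: "('o, 'm) cat \<Rightarrow> 'o \<Rightarrow> 'o \<Rightarrow> 'm set" where
  "hom C A B = {f \<in> Arr C. Dom C f = A \<and> Cod C f = B}"

text \<open>\<open>g \<cdot> f\<close> is ``first \<open>f\<close>, then \<open>g\<close>''. The operations are total functions; nothing is
  assumed about their values outside the objects, the arrows and the composable pairs.\<close>

locale category =
  fixes C :: "('o, 'm) cat" (structure)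
  assumes Dom_Obj: "f \<in> Arr C \<Longrightarrow> Dom C f \<in> Obj C"
    and Cod_Obj: "f \<in> Arr C \<Longrightarrow> Cod C f \<in> Obj C"
    and Ident_hom: "A \<in> Obj C \<Longrightarrow> Ident C A \<in> hom C A A"
    and Comp_hom: "\<lbrakk>f \<in> hom C A B; g \<in> hom C B D\<rbrakk> \<Longrightarrow> g \<cdot> f \<in> hom C A D"
    and Comp_Ident: "f \<in> hom C A B \<Longrightarrow> f \<cdot> Ident C A = f"
    and Ident_Comp: "f \<in> hom C A B \<Longrightarrow> Ident C B \<cdot> f = f"
    and Comp_assoc:
      "\<lbrakk>f \<in> hom C A B; g \<in> hom C B D; h \<in> hom C D E\<rbrakk> \<Longrightarrow> (h \<cdot> g) \<cdot> f = h \<cdot> (g \<cdot> f)"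

record ('o, 'm, 'p, 'n) cfun =
  FObj :: "'o \<Rightarrow> 'p"
  FArr :: "'m \<Rightarrow> 'n"

definition is_functor :: "('o, 'm) cat \<Rightarrow> ('p, 'n) cat \<Rightarrow> ('o, 'm, 'p, 'n) cfun \<Rightarrow> bool" where
  "is_functor C D F \<longleftrightarrow>
     (\<forall>A \<in> Obj C. FObj F A \<in> Obj D) \<and>
     (\<forall>f \<in> Arr C. FArr F f \<in> hom D (FObj F (Dom C f)) (FObj F (Cod C f))) \<and>
     (\<forall>A \<in> Obj C. FArr F (Ident C A) = Ident D (FObj F A)) \<and>
     (\<forall>f \<in> Arr C. \<forall>g \<in> Arr C. Dom C g = Cod C f \<longrightarrow>
        FArr F (g \<cdot>\<^bsub>C\<^esub> f) = FArr F g \<cdot>\<^bsub>D\<^esub> FArr F f)"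

definition is_cone ::
  "('i, 'j) cat \<Rightarrow> ('o, 'm) cat \<Rightarrow> ('i, 'j, 'o, 'm) cfun \<Rightarrow> 'o \<Rightarrow> ('i \<Rightarrow> 'm) \<Rightarrow> bool" where
  "is_cone J C D A p \<longleftrightarrow> A \<in> Obj C \<and>
     (\<forall>j \<in> Obj J. p j \<in> hom C A (FObj D j)) \<and>
     (\<forall>u \<in> Arr J. FArr D u \<cdot>\<^bsub>C\<^esub> p (Dom J u) = p (Cod J u))"

definition is_limit ::
  "('i, 'j) cat \<Rightarrow> ('o, 'm) cat \<Rightarrow> ('i, 'j, 'o, 'm) cfun \<Rightarrow> 'o \<Rightarrow> ('i \<Rightarrow> 'm) \<Rightarrow> bool" where
  "is_limit J C D A p \<longleftrightarrow> is_cone J C D A p \<and>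
     (\<forall>B q. is_cone J C D B q \<longrightarrow>
        (\<exists>!h. h \<in> hom C B A \<and> (\<forall>j \<in> Obj J. p j \<cdot>\<^bsub>C\<^esub> h = q j)))"

text \<open>Every finite category is isomorphic to one whose objects and arrows are natural numbers.\<close>

definition finitely_complete :: "('o, 'm) cat \<Rightarrow> bool" where
  "finitely_complete C \<longleftrightarrow>
     (\<forall>(J :: (nat, nat) cat) D.
        category J \<and> finite (Obj J) \<and> finite (Arr J) \<and> is_functor J C D \<longrightarrow>
        (\<exists>A p. is_limit J C D A p))"

definition is_product :: "('o, 'm) cat \<Rightarrow> 'o \<Rightarrow> 'o \<Rightarrow> 'm \<Rightarrow> 'm \<Rightarrow> bool" where
  "is_product C A B p q \<longleftrightarrow>
     (\<exists>P \<in> Obj C. p \<in> hom C P A \<and> q \<in> hom C P B \<and>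
        (\<forall>T f g. f \<in> hom C T A \<and> g \<in> hom C T B \<longrightarrow>
           (\<exists>!h. h \<in> hom C T P \<and> p \<cdot>\<^bsub>C\<^esub> h = f \<and> q \<cdot>\<^bsub>C\<^esub> h = g)))"

text \<open>\<open>p\<close> and \<open>q\<close> are the projections of a pullback of \<open>f\<close> and \<open>g\<close>, with \<open>f \<cdot> p = g \<cdot> q\<close>.\<close>

definition is_pullback :: "('o, 'm) cat \<Rightarrow> 'm \<Rightarrow> 'm \<Rightarrow> 'm \<Rightarrow> 'm \<Rightarrow> bool" where
  "is_pullback C f g p q \<longleftrightarrow>
     f \<in> Arr C \<and> g \<in> Arr C \<and> Cod C f = Cod C g \<and>
     (\<exists>P \<in> Obj C. p \<in> hom C P (Dom C f) \<and> q \<in> hom C P (Dom C g) \<and> f \<cdot>\<^bsub>C\<^esub> p = g \<cdot>\<^bsub>C\<^esub> q \<and>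
        (\<forall>T a b. a \<in> hom C T (Dom C f) \<and> b \<in> hom C T (Dom C g) \<and> f \<cdot>\<^bsub>C\<^esub> a = g \<cdot>\<^bsub>C\<^esub> b \<longrightarrow>
           (\<exists>!h. h \<in> hom C T P \<and> p \<cdot>\<^bsub>C\<^esub> h = a \<and> q \<cdot>\<^bsub>C\<^esub> h = b)))"

definition is_kernel_pair :: "('o, 'm) cat \<Rightarrow> 'm \<Rightarrow> 'm \<Rightarrow> 'm \<Rightarrow> bool" where
  "is_kernel_pair C f p q \<longleftrightarrow> is_pullback C f f p q"

definition is_coequaliser :: "('o, 'm) cat \<Rightarrow> 'm \<Rightarrow> 'm \<Rightarrow> 'm \<Rightarrow> bool" where
  "is_coequaliser C a b c \<longleftrightarrow>
     a \<in> Arr C \<and> b \<in> hom C (Dom C a) (Cod C a) \<and>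
     c \<in> Arr C \<and> Dom C c = Cod C a \<and> c \<cdot>\<^bsub>C\<^esub> a = c \<cdot>\<^bsub>C\<^esub> b \<and>
     (\<forall>T f. f \<in> hom C (Cod C a) T \<and> f \<cdot>\<^bsub>C\<^esub> a = f \<cdot>\<^bsub>C\<^esub> b \<longrightarrow>
        (\<exists>!h. h \<in> hom C (Cod C c) T \<and> h \<cdot>\<^bsub>C\<^esub> c = f))"

definition monic :: "('o, 'm) cat \<Rightarrow> 'm \<Rightarrow> bool" where
  "monic C m \<longleftrightarrow> m \<in> Arr C \<and>
     (\<forall>T a b. a \<in> hom C T (Dom C m) \<and> b \<in> hom C T (Dom C m) \<and> m \<cdot>\<^bsub>C\<^esub> a = m \<cdot>\<^bsub>C\<^esub> b \<longrightarrow> a = b)"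

definition regular_epi :: "('o, 'm) cat \<Rightarrow> 'm \<Rightarrow> bool" where
  "regular_epi C e \<longleftrightarrow> (\<exists>a b. is_coequaliser C a b e)"

definition iso :: "('o, 'm) cat \<Rightarrow> 'm \<Rightarrow> bool" where
  "iso C f \<longleftrightarrow> f \<in> Arr C \<and>
     (\<exists>g \<in> hom C (Cod C f) (Dom C f).
        g \<cdot>\<^bsub>C\<^esub> f = Ident C (Dom C f) \<and> f \<cdot>\<^bsub>C\<^esub> g = Ident C (Cod C f))"


section \<open>Relations as subobjects of \<open>X \<times> X\<close>\<close>

text \<open>A subobject is represented by a monomorphism; equality of subobjects is
  mutual factorisation of representatives.\<close>

definition sub_le :: "('o, 'm) cat \<Rightarrow> 'm \<Rightarrow> 'm \<Rightarrow> bool" where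
  "sub_le C m n \<longleftrightarrow> (\<exists>h \<in> hom C (Dom C m) (Dom C n). n \<cdot>\<^bsub>C\<^esub> h = m)"

definition same_subobject :: "('o, 'm) cat \<Rightarrow> 'm \<Rightarrow> 'm \<Rightarrow> bool" where
  "same_subobject C m n \<longleftrightarrow>
     monic C m \<and> monic C n \<and> Cod C m = Cod C n \<and> sub_le C m n \<and> sub_le C n m"

text \<open>A choice of the square \<open>X \<times> X\<close>, via its two projections.\<close>

definition square_proj :: "('o, 'm) cat \<Rightarrow> 'o \<Rightarrow> 'm \<times> 'm" where
  "square_proj C X = (SOME pq. is_product C X X (fst pq) (snd pq))"

definition pr1 :: "('o, 'm) cat \<Rightarrow> 'o \<Rightarrow> 'm" where
  "pr1 C X = fst (square_proj C X)"

definition pr2 :: "('o, 'm) cat \<Rightarrow> 'o \<Rightarrow> 'm" where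
  "pr2 C X = snd (square_proj C X)"

definition square :: "('o, 'm) cat \<Rightarrow> 'o \<Rightarrow> 'o" where
  "square C X = Dom C (pr1 C X)"

definition pairing :: "('o, 'm) cat \<Rightarrow> 'o \<Rightarrow> 'm \<Rightarrow> 'm \<Rightarrow> 'm" where
  "pairing C X f g = (THE h. h \<in> hom C (Dom C f) (square C X) \<and>
     pr1 C X \<cdot>\<^bsub>C\<^esub> h = f \<and> pr2 C X \<cdot>\<^bsub>C\<^esub> h = g)"

definition diag :: "('o, 'm) cat \<Rightarrow> 'o \<Rightarrow> 'm" where
  "diag C X = pairing C X (Ident C X) (Ident C X)"

definition relation :: "('o, 'm) cat \<Rightarrow> 'o \<Rightarrow> 'm \<Rightarrow> bool" where
  "relation C X r \<longleftrightarrow> monic C r \<and> Cod C r = square C X"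

definition leg1 :: "('o, 'm) cat \<Rightarrow> 'o \<Rightarrow> 'm \<Rightarrow> 'm" where
  "leg1 C X r = pr1 C X \<cdot>\<^bsub>C\<^esub> r"

definition leg2 :: "('o, 'm) cat \<Rightarrow> 'o \<Rightarrow> 'm \<Rightarrow> 'm" where
  "leg2 C X r = pr2 C X \<cdot>\<^bsub>C\<^esub> r"

definition equivalence_relation :: "('o, 'm) cat \<Rightarrow> 'o \<Rightarrow> 'm \<Rightarrow> bool" where
  "equivalence_relation C X r \<longleftrightarrow> relation C X r \<and>
     (\<exists>\<rho> \<in> hom C X (Dom C r).
        leg1 C X r \<cdot>\<^bsub>C\<^esub> \<rho> = Ident C X \<and> leg2 C X r \<cdot>\<^bsub>C\<^esub> \<rho> = Ident C X) \<and>
     (\<exists>\<sigma> \<in> hom C (Dom C r) (Dom C r).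
        leg1 C X r \<cdot>\<^bsub>C\<^esub> \<sigma> = leg2 C X r \<and> leg2 C X r \<cdot>\<^bsub>C\<^esub> \<sigma> = leg1 C X r) \<and>
     (\<forall>p q. is_pullback C (leg2 C X r) (leg1 C X r) p q \<longrightarrow>
        (\<exists>\<tau> \<in> hom C (Dom C p) (Dom C r).
           leg1 C X r \<cdot>\<^bsub>C\<^esub> \<tau> = leg1 C X r \<cdot>\<^bsub>C\<^esub> p \<and> leg2 C X r \<cdot>\<^bsub>C\<^esub> \<tau> = leg2 C X r \<cdot>\<^bsub>C\<^esub> q))"

definition effective :: "('o, 'm) cat \<Rightarrow> 'o \<Rightarrow> 'm \<Rightarrow> bool" where
  "effective C X r \<longleftrightarrow> (\<exists>f. is_kernel_pair C f (leg1 C X r) (leg2 C X r))"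

text \<open>In generalised elements, \<open>R \<circ> S\<close> is \<open>{(x, z). \<exists>y. (x, y) \<in> S \<and> (y, z) \<in> R}\<close>: the image
  (regular epimorphism followed by monomorphism) of the pullback of \<open>leg2 S\<close> and \<open>leg1 R\<close> in
  \<open>X \<times> X\<close>. It is determined up to equality of subobjects; a representative is chosen.\<close>

definition is_rel_comp :: "('o, 'm) cat \<Rightarrow> 'o \<Rightarrow> 'm \<Rightarrow> 'm \<Rightarrow> 'm \<Rightarrow> bool" where
  "is_rel_comp C X r s t \<longleftrightarrow> relation C X t \<and>
     (\<exists>p q e. is_pullback C (leg2 C X s) (leg1 C X r) p q \<and>
        regular_epi C e \<and> e \<in> hom C (Dom C p) (Dom C t) \<and>
        t \<cdot>\<^bsub>C\<^esub> e = pairing C X (leg1 C X s \<cdot>\<^bsub>C\<^esub> p) (leg2 C X r \<cdot>\<^bsub>C\<^esub> q))"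

definition rel_comp :: "('o, 'm) cat \<Rightarrow> 'o \<Rightarrow> 'm \<Rightarrow> 'm \<Rightarrow> 'm" where
  "rel_comp C X r s = (SOME t. is_rel_comp C X r s t)"


section \<open>Exact Goursat categories\<close>

definition regular_category :: "('o, 'm) cat \<Rightarrow> bool" where
  "regular_category C \<longleftrightarrow> category C \<and> finitely_complete C \<and>
     (\<forall>f p q. is_kernel_pair C f p q \<longrightarrow> (\<exists>c. is_coequaliser C p q c)) \<and>
     (\<forall>f g p q. is_pullback C f g p q \<and> regular_epi C f \<longrightarrow> regular_epi C q)"

definition exact_category :: "('o, 'm) cat \<Rightarrow> bool" where
  "exact_category C \<longleftrightarrow> regular_category C \<and>
     (\<forall>X \<in> Obj C. \<forall>r. equivalence_relation C X r \<longrightarrow> effective C X r)"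

definition exact_goursat_category :: "('o, 'm) cat \<Rightarrow> bool" where
  "exact_goursat_category C \<longleftrightarrow> exact_category C \<and>
     (\<forall>X \<in> Obj C. \<forall>r s. equivalence_relation C X r \<and> equivalence_relation C X s \<longrightarrow>
        same_subobject C (rel_comp C X r (rel_comp C X s r)) (rel_comp C X s (rel_comp C X r s)))"


section \<open>Birkhoff subcategories and their closure operators\<close>

text \<open>A full subcategory is given by its set \<open>L\<close> of objects.\<close>

definition full_subcat :: "('o, 'm) cat \<Rightarrow> 'o set \<Rightarrow> ('o, 'm) cat" where
  "full_subcat C L = C\<lparr>Obj := L, Arr := {f \<in> Arr C. Dom C f \<in> L \<and> Cod C f \<in> L}\<rparr>"

definition inclusion :: "('o, 'm, 'o, 'm) cfun" where
  "inclusion = \<lparr>FObj = (\<lambda>A. A), FArr = (\<lambda>f. f)\<rparr>"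

text \<open>\<open>F : C \<rightarrow> D\<close> is left adjoint to \<open>G : D \<rightarrow> C\<close>, with unit \<open>\<eta>\<close>.\<close>

definition left_adjoint ::
  "('o, 'm) cat \<Rightarrow> ('p, 'n) cat \<Rightarrow> ('o, 'm, 'p, 'n) cfun \<Rightarrow> ('p, 'n, 'o, 'm) cfun \<Rightarrow>
    ('o \<Rightarrow> 'm) \<Rightarrow> bool" where
  "left_adjoint C D F G \<eta> \<longleftrightarrow>
     is_functor C D F \<and> is_functor D C G \<and>
     (\<forall>A \<in> Obj C. \<eta> A \<in> hom C A (FObj G (FObj F A))) \<and>
     (\<forall>f \<in> Arr C. FArr G (FArr F f) \<cdot>\<^bsub>C\<^esub> \<eta> (Dom C f) = \<eta> (Cod C f) \<cdot>\<^bsub>C\<^esub> f) \<and>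
     (\<forall>A \<in> Obj C. \<forall>B \<in> Obj D. \<forall>f \<in> hom C A (FObj G B).
        \<exists>!g. g \<in> hom D (FObj F A) B \<and> FArr G g \<cdot>\<^bsub>C\<^esub> \<eta> A = f)"

definition epireflective_subcategory ::
  "('o, 'm) cat \<Rightarrow> 'o set \<Rightarrow> ('o, 'm, 'o, 'm) cfun \<Rightarrow> ('o \<Rightarrow> 'm) \<Rightarrow> bool" where
  "epireflective_subcategory C L \<Lambda> \<eta> \<longleftrightarrow>
     L \<subseteq> Obj C \<and>
     (\<forall>f. iso C f \<and> Dom C f \<in> L \<longrightarrow> Cod C f \<in> L) \<and>
     left_adjoint C (full_subcat C L) \<Lambda> inclusion \<eta> \<and>
     (\<forall>A \<in> Obj C. regular_epi C (\<eta> A))"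

definition birkhoff_subcategory ::
  "('o, 'm) cat \<Rightarrow> 'o set \<Rightarrow> ('o, 'm, 'o, 'm) cfun \<Rightarrow> ('o \<Rightarrow> 'm) \<Rightarrow> bool" where
  "birkhoff_subcategory C L \<Lambda> \<eta> \<longleftrightarrow>
     epireflective_subcategory C L \<Lambda> \<eta> \<and>
     (\<forall>f. regular_epi C f \<and> Dom C f \<in> L \<longrightarrow> Cod C f \<in> L)"

text \<open>The closure of \<open>s\<close> is the kernel pair of \<open>\<eta> (X/S) \<cdot> q\<close>, where \<open>q : X \<rightarrow> X/S\<close> is a coequaliser
  of the legs of \<open>s\<close>; again a representative is chosen.\<close>

definition is_birkhoff_closure ::
  "('o, 'm) cat \<Rightarrow> ('o \<Rightarrow> 'm) \<Rightarrow> 'o \<Rightarrow> 'm \<Rightarrow> 'm \<Rightarrow> bool" where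
  "is_birkhoff_closure C \<eta> X s t \<longleftrightarrow> relation C X t \<and>
     (\<exists>q. is_coequaliser C (leg1 C X s) (leg2 C X s) q \<and>
        is_kernel_pair C (\<eta> (Cod C q) \<cdot>\<^bsub>C\<^esub> q) (leg1 C X t) (leg2 C X t))"

definition birkhoff_closure :: "('o, 'm) cat \<Rightarrow> ('o \<Rightarrow> 'm) \<Rightarrow> 'o \<Rightarrow> 'm \<Rightarrow> 'm" where
  "birkhoff_closure C \<eta> X s = (SOME t. is_birkhoff_closure C \<eta> X s t)"

end

theory Submission
  imports Defs
begin

text \<open>
  Write \<open>K\<close> for the closure of the diagonal, that is, the kernel pair of \<open>\<eta> X\<close>. Relations are handled
  by generalised elements (\<open>related\<close>). In a regular category, \<open>(x, z)\<close> belongs to a composite as soon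
  as a middle element exists after pulling back along a regular epimorphism
  (\<open>related_rel_compI\<close>, \<open>related_rel_compE\<close>), and membership in any relation can be checked after
  such a pullback (\<open>related_descent\<close>). Hence composites can be calculated with as if objects were
  sets.

  The Goursat identity \<open>K \<circ> S \<circ> K = S \<circ> K \<circ> S\<close> makes \<open>T = K \<circ> S \<circ> K\<close> transitive, so \<open>T\<close> is an
  equivalence relation (\<open>sandwich_equivalence_relation\<close>), namely the join of \<open>K\<close> and \<open>S\<close>. The
  closure of \<open>S\<close> is an equivalence relation containing \<open>S\<close> and, by naturality of \<open>\<eta>\<close>, also \<open>K\<close>; so it
  contains \<open>T\<close>. Conversely, by exactness \<open>T\<close> is the kernel pair of its quotient map \<open>X \<rightarrow> X/T\<close>. Since
  \<open>K\<close> is contained in \<open>T\<close>, the object \<open>X/T\<close> is a regular quotient of the reflection of \<open>X\<close>, and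
  therefore lies in the Birkhoff subcategory. The map \<open>X/S \<rightarrow> X/T\<close> then factors through the reflection
  of \<open>X/S\<close>, which says that the closure of \<open>S\<close> is contained in \<open>T\<close>
  (\<open>birkhoff_closure_sandwich\<close>).
\<close>

section \<open>Arrows, products and pullbacks\<close>

lemma hom_iff [simp]: "f \<in> hom C A B \<longleftrightarrow> f \<in> Arr C \<and> Dom C f = A \<and> Cod C f = B"
  by (simp add: hom_def)

context category
begin

lemma Ident_simps [simp]:
  assumes "A \<in> Obj C"
  shows "Ident C A \<in> Arr C" "Dom C (Ident C A) = A" "Cod C (Ident C A) = A"
  using Ident_hom[OF assms] by auto

lemma Comp_simps [simp]:
  assumes "f \<in> Arr C" "g \<in> Arr C" "Cod C f = Dom C g"
  shows "g \<cdot> f \<in> Arr C" "Dom C (g \<cdot> f) = Dom C f" "Cod C (g \<cdot> f) = Cod C g"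
  using Comp_hom[of f "Dom C f" "Dom C g" g "Cod C g"] assms by auto

lemma Comp_Ident_simp [simp]: "f \<in> Arr C \<Longrightarrow> Dom C f = A \<Longrightarrow> f \<cdot> Ident C A = f"
  using Comp_Ident[of f A "Cod C f"] by simp

lemma Ident_Comp_simp [simp]: "f \<in> Arr C \<Longrightarrow> Cod C f = B \<Longrightarrow> Ident C B \<cdot> f = f"
  using Ident_Comp[of f "Dom C f" B] by simp

lemma assoc:
  assumes "f \<in> Arr C" "g \<in> Arr C" "h \<in> Arr C" "Cod C f = Dom C g" "Cod C g = Dom C h"
  shows "(h \<cdot> g) \<cdot> f = h \<cdot> (g \<cdot> f)"
  using Comp_assoc[of f "Dom C f" "Dom C g" g "Dom C h" h "Cod C h"] assms by simp

lemma square_whisker: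
  assumes "f \<cdot> p = g \<cdot> q" "h \<in> Arr C" "p \<in> Arr C" "q \<in> Arr C" "f \<in> Arr C" "g \<in> Arr C"
    "Cod C h = Dom C p" "Cod C h = Dom C q" "Cod C p = Dom C f" "Cod C q = Dom C g"
  shows "f \<cdot> (p \<cdot> h) = g \<cdot> (q \<cdot> h)"
  using assms(1) assoc[of h p f] assoc[of h q g] assms(2-) by simp

lemma product_exists:
  assumes fc: "finitely_complete C" and A: "A \<in> Obj C" and B: "B \<in> Obj C"
  shows "\<exists>p q. is_product C A B p q"
proof -
  \<comment> \<open>The discrete category on two objects, each arrow being identified with its object.\<close>
  define J :: "(nat, nat) cat" where
    "J = \<lparr>Obj = {0, 1}, Arr = {0, 1}, Dom = (\<lambda>u. u), Cod = (\<lambda>u. u), Ident = (\<lambda>j. j),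
          Comp = (\<lambda>g f. f)\<rparr>"
  define D where "D = \<lparr>FObj = (\<lambda>j::nat. if j = 0 then A else B),
                       FArr = (\<lambda>j::nat. if j = 0 then Ident C A else Ident C B)\<rparr>"
  have "category J" by standard (auto simp: J_def)
  moreover have "is_functor J C D" using A B by (auto simp: is_functor_def J_def D_def)
  moreover have "finite (Obj J)" "finite (Arr J)" by (auto simp: J_def)
  ultimately obtain P p where lim: "is_limit J C D P p"
    using fc unfolding finitely_complete_def by blast
  have cone: "is_cone J C D Q q \<longleftrightarrow> Q \<in> Obj C \<and> q 0 \<in> hom C Q A \<and> q 1 \<in> hom C Q B" for Q q
    using A B by (auto simp: is_cone_def J_def D_def)
  have P: "P \<in> Obj C" "p 0 \<in> hom C P A" "p 1 \<in> hom C P B"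
    using lim cone by (auto simp: is_limit_def)
  have "\<exists>!h. h \<in> hom C T P \<and> p 0 \<cdot> h = f \<and> p 1 \<cdot> h = g"
    if "f \<in> hom C T A" "g \<in> hom C T B" for T f g
  proof -
    define q where "q = (\<lambda>j::nat. if j = 0 then f else g)"
    have "is_cone J C D T q" unfolding cone using that Dom_Obj by (auto simp: q_def)
    then have "\<exists>!h. h \<in> hom C T P \<and> (\<forall>j \<in> Obj J. p j \<cdot> h = q j)"
      using lim unfolding is_limit_def by blast
    then show ?thesis by (simp add: J_def q_def)
  qed
  then have "is_product C A B (p 0) (p 1)"
    unfolding is_product_def using P by blast
  then show ?thesis by blast
qed

lemma pullback_exists:
  assumes fc: "finitely_complete C"
    and f: "f \<in> Arr C" and g: "g \<in> Arr C" and fg: "Cod C f = Cod C g"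
  shows "\<exists>p q. is_pullback C f g p q"
proof -
  \<comment> \<open>The cospan \<open>0 \<rightarrow> 2 \<leftarrow> 1\<close>: the arrows \<open>0\<close>, \<open>1\<close>, \<open>2\<close> are identities, \<open>3\<close> and \<open>4\<close> are the two
    proper arrows.\<close>
  define J :: "(nat, nat) cat" where
    "J = \<lparr>Obj = {0, 1, 2}, Arr = {0, 1, 2, 3, 4},
          Dom = (\<lambda>u. if u = 3 then 0 else if u = 4 then 1 else u),
          Cod = (\<lambda>u. if u = 3 \<or> u = 4 then 2 else u), Ident = (\<lambda>j. j),
          Comp = (\<lambda>g f. if f = 3 \<or> f = 4 then f else g)\<rparr>"
  define D where "D = \<lparr>FObj = (\<lambda>j::nat. if j = 0 then Dom C f else if j = 1 then Dom C g else Cod C f),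
      FArr = (\<lambda>j::nat. if j = 0 then Ident C (Dom C f) else if j = 1 then Ident C (Dom C g)
                else if j = 2 then Ident C (Cod C f) else if j = 3 then f else g)\<rparr>"
  note objs = Dom_Obj[OF f] Dom_Obj[OF g] Cod_Obj[OF f] Cod_Obj[OF g]
  have "category J"
    by standard (auto simp: J_def split: if_splits)
  moreover have "is_functor J C D"
    using f g fg objs by (auto simp: is_functor_def J_def D_def)
  moreover have "finite (Obj J)" "finite (Arr J)" by (auto simp: J_def)
  ultimately obtain P p where lim: "is_limit J C D P p"
    using fc unfolding finitely_complete_def by blast
  have cone: "is_cone J C D Q q \<longleftrightarrow> Q \<in> Obj C \<and> q 0 \<in> hom C Q (Dom C f) \<and> q 1 \<in> hom C Q (Dom C g)
      \<and> f \<cdot> q 0 = q 2 \<and> g \<cdot> q 1 = q 2" for Q q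
  proof -
    have "q 2 \<in> hom C Q (Cod C f)" if "q 0 \<in> hom C Q (Dom C f)" "f \<cdot> q 0 = q 2"
      using that f Comp_simps[of "q 0" f] by auto
    then show ?thesis using f g fg objs by (auto simp: is_cone_def J_def D_def)
  qed
  have P: "P \<in> Obj C" "p 0 \<in> hom C P (Dom C f)" "p 1 \<in> hom C P (Dom C g)"
    "f \<cdot> p 0 = p 2" "g \<cdot> p 1 = p 2"
    using lim cone by (auto simp: is_limit_def)
  have "\<exists>!h. h \<in> hom C T P \<and> p 0 \<cdot> h = a \<and> p 1 \<cdot> h = b"
    if a: "a \<in> hom C T (Dom C f)" and b: "b \<in> hom C T (Dom C g)" and ab: "f \<cdot> a = g \<cdot> b" for T a b
  proof -
    define q where "q = (\<lambda>j::nat. if j = 0 then a else if j = 1 then b else f \<cdot> a)"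
    have "is_cone J C D T q" unfolding cone using a b ab Dom_Obj by (auto simp: q_def)
    then have ex: "\<exists>!h. h \<in> hom C T P \<and> (\<forall>j \<in> Obj J. p j \<cdot> h = q j)"
      using lim unfolding is_limit_def by blast
    \<comment> \<open>The condition at the vertex \<open>2\<close> follows from the one at \<open>0\<close>.\<close>
    have "p 2 \<cdot> h = f \<cdot> a" if "h \<in> hom C T P" "p 0 \<cdot> h = a" for h
    proof -
      have "p 2 \<cdot> h = (f \<cdot> p 0) \<cdot> h" using P by simp
      also have "\<dots> = f \<cdot> (p 0 \<cdot> h)" using P that f by (intro assoc) auto
      finally show ?thesis using that by simp
    qed
    then have "h \<in> hom C T P \<and> (\<forall>j \<in> Obj J. p j \<cdot> h = q j)
        \<longleftrightarrow> h \<in> hom C T P \<and> p 0 \<cdot> h = a \<and> p 1 \<cdot> h = b" for h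
      by (auto simp: J_def q_def)
    then show ?thesis using ex by simp
  qed
  then have "is_pullback C f g (p 0) (p 1)"
    unfolding is_pullback_def using P f g fg by (intro conjI bexI[of _ P]) auto
  then show ?thesis by blast
qed

lemma pullbackD:
  assumes "is_pullback C f g p q"
  shows "f \<in> Arr C" "g \<in> Arr C" "Cod C f = Cod C g" "p \<in> Arr C" "q \<in> Arr C"
    "Dom C q = Dom C p" "Cod C p = Dom C f" "Cod C q = Dom C g" "f \<cdot> p = g \<cdot> q"
  using assms unfolding is_pullback_def by auto

lemma pullback_universal:
  assumes "is_pullback C f g p q" "a \<in> hom C T (Dom C f)" "b \<in> hom C T (Dom C g)" "f \<cdot> a = g \<cdot> b"
  shows "\<exists>!h. h \<in> hom C T (Dom C p) \<and> p \<cdot> h = a \<and> q \<cdot> h = b"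
proof -
  obtain P where P: "p \<in> hom C P (Dom C f)"
    "\<forall>T a b. a \<in> hom C T (Dom C f) \<and> b \<in> hom C T (Dom C g) \<and> f \<cdot> a = g \<cdot> b \<longrightarrow>
           (\<exists>!h. h \<in> hom C T P \<and> p \<cdot> h = a \<and> q \<cdot> h = b)"
    using assms(1) unfolding is_pullback_def by blast
  from P(1) have "P = Dom C p" by simp
  with P(2) assms(2-4) show ?thesis by blast
qed

lemma coequaliserD:
  assumes "is_coequaliser C a b c"
  shows "a \<in> Arr C" "b \<in> Arr C" "c \<in> Arr C" "Dom C b = Dom C a" "Cod C b = Cod C a"
    "Cod C a = Dom C c" "c \<cdot> a = c \<cdot> b"
  using assms unfolding is_coequaliser_def by auto

lemma coequaliser_factor:
  assumes "is_coequaliser C a b c" "k \<in> Arr C" "Dom C k = Dom C c" "k \<cdot> a = k \<cdot> b"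
  shows "\<exists>l. l \<in> hom C (Cod C c) (Cod C k) \<and> l \<cdot> c = k"
  using assms unfolding is_coequaliser_def by (metis hom_iff)

lemma coequaliser_epic:
  assumes c: "is_coequaliser C a b c" and u: "u \<in> hom C (Cod C c) Z" and v: "v \<in> hom C (Cod C c) Z"
    and uv: "u \<cdot> c = v \<cdot> c"
  shows "u = v"
proof -
  note cD = coequaliserD[OF c]
  have "(u \<cdot> c) \<cdot> a = (u \<cdot> c) \<cdot> b"
    using cD u by (simp add: assoc)
  moreover have "u \<cdot> c \<in> hom C (Cod C a) Z" using cD u by simp
  ultimately have "\<exists>!h. h \<in> hom C (Cod C c) Z \<and> h \<cdot> c = u \<cdot> c"
    using c unfolding is_coequaliser_def by blast
  then show ?thesis using u v uv by metis
qed

lemma regular_epi_arr: "regular_epi C e \<Longrightarrow> e \<in> Arr C"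
  unfolding regular_epi_def using coequaliserD by blast

lemma regular_epi_epic:
  "\<lbrakk>regular_epi C e; u \<in> hom C (Cod C e) Z; v \<in> hom C (Cod C e) Z; u \<cdot> e = v \<cdot> e\<rbrakk> \<Longrightarrow> u = v"
  unfolding regular_epi_def using coequaliser_epic by blast

text \<open>If \<open>g \<cdot> e\<close> is a coequaliser of \<open>a\<close> and \<open>b\<close> and \<open>e\<close> is epic, then \<open>g\<close> is a coequaliser of
  \<open>e \<cdot> a\<close> and \<open>e \<cdot> b\<close>.\<close>

lemma regular_epi_cancel:
  assumes e: "regular_epi C e" and g: "g \<in> Arr C" "Dom C g = Cod C e" and ge: "regular_epi C (g \<cdot> e)"
  shows "regular_epi C g"
proof -
  obtain a b where co: "is_coequaliser C a b (g \<cdot> e)" using ge unfolding regular_epi_def by blast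
  note eA = regular_epi_arr[OF e]
  note cD = coequaliserD[OF co]
  have D: "Cod C a = Dom C e" using cD g eA by simp
  have "is_coequaliser C (e \<cdot> a) (e \<cdot> b) g"
    unfolding is_coequaliser_def
  proof (intro conjI allI impI)
    show "g \<cdot> e \<cdot> a = g \<cdot> e \<cdot> b" using cD D g eA by (simp add: assoc)
  next
    fix T f assume "f \<in> hom C (Cod C (e \<cdot> a)) T \<and> f \<cdot> e \<cdot> a = f \<cdot> e \<cdot> b"
    then have f: "f \<in> Arr C" "Dom C f = Cod C e" "Cod C f = T" "f \<cdot> e \<cdot> a = f \<cdot> e \<cdot> b"
      using cD D eA by auto
    then obtain h where h: "h \<in> hom C (Cod C g) T" "h \<cdot> (g \<cdot> e) = f \<cdot> e"
      using coequaliser_factor[OF co, of "f \<cdot> e"] cD D g eA by (auto simp: assoc)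
    have hg: "h \<cdot> g = f"
      using regular_epi_epic[OF e, of "h \<cdot> g" T f] h f g eA by (simp add: assoc)
    show "\<exists>!h. h \<in> hom C (Cod C g) T \<and> h \<cdot> g = f"
    proof (intro ex1I[of _ h] conjI)
      fix h' assume h': "h' \<in> hom C (Cod C g) T \<and> h' \<cdot> g = f"
      then have "h' \<cdot> (g \<cdot> e) = h \<cdot> (g \<cdot> e)"
        using h f g eA by (simp add: assoc[symmetric])
      then show "h' = h" using coequaliser_epic[OF co, of h' T h] h' h g eA by simp
    qed (use h hg in auto)
  qed (use cD D g eA in auto)
  then show ?thesis unfolding regular_epi_def by blast
qed

end

section \<open>Relations through their generalised elements\<close>

text \<open>A pair of generalised elements \<open>x\<close>, \<open>y\<close> of \<open>X\<close> lies in \<open>r\<close> when \<open>(x, y)\<close> factors through \<open>r\<close>.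
  Formulating the factorisation with the two legs keeps pairings out of the calculations.\<close>

definition related :: "('o, 'm) cat \<Rightarrow> 'o \<Rightarrow> 'm \<Rightarrow> 'm \<Rightarrow> 'm \<Rightarrow> bool" where
  "related C X r x y \<longleftrightarrow>
     (\<exists>h \<in> hom C (Dom C x) (Dom C r). leg1 C X r \<cdot>\<^bsub>C\<^esub> h = x \<and> leg2 C X r \<cdot>\<^bsub>C\<^esub> h = y)"

locale regular = category +
  assumes regular: "regular_category C"
begin

lemma complete: "finitely_complete C"
  using regular by (simp add: regular_category_def)

lemma square_is_product:
  assumes "X \<in> Obj C"
  shows "is_product C X X (pr1 C X) (pr2 C X)"
proof -
  have "\<exists>pq. is_product C X X (fst pq) (snd pq)"
    using product_exists[OF complete assms assms] by auto
  then show ?thesis unfolding pr1_def pr2_def square_proj_def by (rule someI_ex)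
qed

lemma pr_simps [simp]:
  assumes "X \<in> Obj C"
  shows "pr1 C X \<in> Arr C" "pr2 C X \<in> Arr C" "Dom C (pr1 C X) = square C X"
    "Dom C (pr2 C X) = square C X" "Cod C (pr1 C X) = X" "Cod C (pr2 C X) = X"
  using square_is_product[OF assms] unfolding is_product_def square_def by auto

lemma square_universal:
  assumes "X \<in> Obj C" "f \<in> hom C T X" "g \<in> hom C T X"
  shows "\<exists>!h. h \<in> hom C T (square C X) \<and> pr1 C X \<cdot> h = f \<and> pr2 C X \<cdot> h = g"
proof -
  obtain P where P: "pr1 C X \<in> hom C P X" "\<forall>T f g. f \<in> hom C T X \<and> g \<in> hom C T X \<longrightarrow>
           (\<exists>!h. h \<in> hom C T P \<and> pr1 C X \<cdot> h = f \<and> pr2 C X \<cdot> h = g)"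
    using square_is_product[OF assms(1)] unfolding is_product_def by blast
  from P(1) have "P = square C X" by (simp add: square_def)
  with P(2) assms show ?thesis by blast
qed

lemma pairing:
  assumes "X \<in> Obj C" "f \<in> hom C T X" "g \<in> hom C T X"
  shows "pairing C X f g \<in> hom C T (square C X)" "pr1 C X \<cdot> pairing C X f g = f"
    "pr2 C X \<cdot> pairing C X f g = g"
proof -
  have "Dom C f = T" using assms by simp
  then show "pairing C X f g \<in> hom C T (square C X)" "pr1 C X \<cdot> pairing C X f g = f"
    "pr2 C X \<cdot> pairing C X f g = g"
    using theI'[OF square_universal[OF assms]] unfolding pairing_def by auto
qed

lemma square_eqI:
  assumes "X \<in> Obj C" "u \<in> hom C T (square C X)" "v \<in> hom C T (square C X)"
    "pr1 C X \<cdot> u = pr1 C X \<cdot> v" "pr2 C X \<cdot> u = pr2 C X \<cdot> v"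
  shows "u = v"
  using square_universal[of X "pr1 C X \<cdot> v" T "pr2 C X \<cdot> v"] assms by auto

lemma relation_simps:
  assumes "X \<in> Obj C" "relation C X r"
  shows "r \<in> Arr C" "Cod C r = square C X"
    "leg1 C X r \<in> Arr C" "leg2 C X r \<in> Arr C" "Dom C (leg1 C X r) = Dom C r"
    "Dom C (leg2 C X r) = Dom C r" "Cod C (leg1 C X r) = X" "Cod C (leg2 C X r) = X"
proof -
  show r: "r \<in> Arr C" "Cod C r = square C X" using assms by (auto simp: relation_def monic_def)
  show "leg1 C X r \<in> Arr C" "leg2 C X r \<in> Arr C" "Dom C (leg1 C X r) = Dom C r"
    "Dom C (leg2 C X r) = Dom C r" "Cod C (leg1 C X r) = X" "Cod C (leg2 C X r) = X"
    using assms r by (auto simp: leg1_def leg2_def)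
qed

lemma leg_comp:
  assumes "X \<in> Obj C" "r \<in> Arr C" "Cod C r = square C X" "h \<in> Arr C" "Cod C h = Dom C r"
  shows "leg1 C X r \<cdot> h = pr1 C X \<cdot> (r \<cdot> h)" "leg2 C X r \<cdot> h = pr2 C X \<cdot> (r \<cdot> h)"
  using assms by (auto simp: leg1_def leg2_def assoc)

lemma legs_jointly_monic:
  assumes X: "X \<in> Obj C" and r: "relation C X r"
    and u: "u \<in> hom C T (Dom C r)" and v: "v \<in> hom C T (Dom C r)"
    and "leg1 C X r \<cdot> u = leg1 C X r \<cdot> v" "leg2 C X r \<cdot> u = leg2 C X r \<cdot> v"
  shows "u = v"
proof -
  note rD = relation_simps[OF X r]
  have "r \<cdot> u = r \<cdot> v"
    by (rule square_eqI[OF X, of _ T])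
      (use assms(5,6) u v rD(1,2) leg_comp[OF X rD(1,2), of u] leg_comp[OF X rD(1,2), of v] in auto)
  then show ?thesis using r u v unfolding relation_def monic_def by blast
qed

lemma jointly_monic_relation:
  assumes X: "X \<in> Obj C" and a: "a \<in> hom C P X" and b: "b \<in> hom C P X"
    and mono: "\<And>T u v. \<lbrakk>u \<in> hom C T P; v \<in> hom C T P; a \<cdot> u = a \<cdot> v; b \<cdot> u = b \<cdot> v\<rbrakk> \<Longrightarrow> u = v"
  shows "relation C X (pairing C X a b)" "leg1 C X (pairing C X a b) = a"
    "leg2 C X (pairing C X a b) = b"
proof -
  note pD = pairing[OF X a b]
  show l: "leg1 C X (pairing C X a b) = a" "leg2 C X (pairing C X a b) = b"
    using pD by (auto simp: leg1_def leg2_def)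
  have "u = v" if "u \<in> hom C T P" "v \<in> hom C T P" "pairing C X a b \<cdot> u = pairing C X a b \<cdot> v" for T u v
    by (rule mono[OF that(1,2)])
      (use leg_comp[OF X, of "pairing C X a b" u] leg_comp[OF X, of "pairing C X a b" v] pD l that in auto)
  then show "relation C X (pairing C X a b)"
    using pD unfolding relation_def monic_def by auto
qed

lemma relatedD:
  assumes "X \<in> Obj C" "relation C X r" "related C X r x y"
  shows "x \<in> Arr C" "y \<in> Arr C" "Dom C y = Dom C x" "Cod C x = X" "Cod C y = X"
proof -
  obtain h where h: "h \<in> hom C (Dom C x) (Dom C r)" "leg1 C X r \<cdot> h = x" "leg2 C X r \<cdot> h = y"
    using assms(3) unfolding related_def by blast
  then show "x \<in> Arr C" "y \<in> Arr C" "Dom C y = Dom C x" "Cod C x = X" "Cod C y = X"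
    using relation_simps[OF assms(1,2)] Comp_simps[of h "leg1 C X r"] Comp_simps[of h "leg2 C X r"]
    by simp_all
qed

lemma related_legs:
  assumes "X \<in> Obj C" "relation C X r"
  shows "related C X r (leg1 C X r) (leg2 C X r)"
  using relation_simps[OF assms] Dom_Obj unfolding related_def
  by (intro bexI[of _ "Ident C (Dom C r)"]) auto

lemma related_comp:
  assumes X: "X \<in> Obj C" and r: "relation C X r" and xy: "related C X r x y"
    and e: "e \<in> Arr C" "Cod C e = Dom C x"
  shows "related C X r (x \<cdot> e) (y \<cdot> e)"
proof -
  note rD = relation_simps[OF X r] and xyD = relatedD[OF X r xy]
  obtain h where "h \<in> hom C (Dom C x) (Dom C r)" "leg1 C X r \<cdot> h = x" "leg2 C X r \<cdot> h = y"
    using xy unfolding related_def by blast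
  then show ?thesis unfolding related_def using e rD xyD
    by (intro bexI[of _ "h \<cdot> e"]) (auto simp: assoc[symmetric])
qed

lemma sub_leI:
  assumes X: "X \<in> Obj C" and r: "relation C X r" and s: "relation C X s"
    and le: "\<And>x y. related C X r x y \<Longrightarrow> related C X s x y"
  shows "sub_le C r s"
proof -
  note rD = relation_simps[OF X r] and sD = relation_simps[OF X s]
  from le[OF related_legs[OF X r]] obtain h where
    h: "h \<in> hom C (Dom C r) (Dom C s)" "leg1 C X s \<cdot> h = leg1 C X r" "leg2 C X s \<cdot> h = leg2 C X r"
    unfolding related_def using rD by auto
  have "s \<cdot> h = r"
    by (rule square_eqI[OF X, of _ "Dom C r"])
      (use h rD sD leg_comp[OF X sD(1,2), of h] in \<open>auto simp: leg1_def leg2_def\<close>)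
  with h show ?thesis unfolding sub_le_def by blast
qed

lemma related_mono:
  assumes X: "X \<in> Obj C" and r: "relation C X r" and s: "relation C X s"
    and le: "sub_le C r s" and xy: "related C X r x y"
  shows "related C X s x y"
proof -
  note rD = relation_simps[OF X r] and sD = relation_simps[OF X s]
  obtain k where k: "k \<in> hom C (Dom C r) (Dom C s)" "s \<cdot> k = r"
    using le unfolding sub_le_def by blast
  obtain h where h: "h \<in> hom C (Dom C x) (Dom C r)" "leg1 C X r \<cdot> h = x" "leg2 C X r \<cdot> h = y"
    using xy unfolding related_def by blast
  have "s \<cdot> (k \<cdot> h) = r \<cdot> h" using k h sD by (auto simp: assoc[symmetric])
  then have "leg1 C X s \<cdot> (k \<cdot> h) = x" "leg2 C X s \<cdot> (k \<cdot> h) = y"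
    using leg_comp[OF X sD(1,2), of "k \<cdot> h"] leg_comp[OF X rD(1,2), of h] k h by auto
  then show ?thesis unfolding related_def using k h by (intro bexI[of _ "k \<cdot> h"]) auto
qed

lemma same_subobjectI:
  assumes "X \<in> Obj C" "relation C X r" "relation C X s"
    and "\<And>x y. related C X r x y \<longleftrightarrow> related C X s x y"
  shows "same_subobject C r s"
  unfolding same_subobject_def
  using sub_leI[OF assms(1,2,3)] sub_leI[OF assms(1,3,2)] assms by (auto simp: relation_def)

text \<open>The structure maps arise by applying the elementwise laws to universal elements: the identity
  of \<open>X\<close> for reflexivity, the two legs for symmetry, and the legs composed with the projections of
  the pullback for transitivity.\<close>

lemma equivalence_relationI:
  assumes X: "X \<in> Obj C" and r: "relation C X r"
    and refl: "\<And>x. \<lbrakk>x \<in> Arr C; Cod C x = X\<rbrakk> \<Longrightarrow> related C X r x x"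
    and sym: "\<And>x y. related C X r x y \<Longrightarrow> related C X r y x"
    and trans: "\<And>x y z. \<lbrakk>related C X r x y; related C X r y z\<rbrakk> \<Longrightarrow> related C X r x z"
  shows "equivalence_relation C X r"
  unfolding equivalence_relation_def
proof (intro conjI allI impI)
  note rD = relation_simps[OF X r]
  show "relation C X r" by fact
  show "\<exists>\<rho> \<in> hom C X (Dom C r). leg1 C X r \<cdot> \<rho> = Ident C X \<and> leg2 C X r \<cdot> \<rho> = Ident C X"
    using refl[of "Ident C X"] X unfolding related_def by auto
  show "\<exists>\<sigma> \<in> hom C (Dom C r) (Dom C r). leg1 C X r \<cdot> \<sigma> = leg2 C X r \<and> leg2 C X r \<cdot> \<sigma> = leg1 C X r"
    using sym[OF related_legs[OF X r]] rD unfolding related_def by auto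
  fix p q assume pq: "is_pullback C (leg2 C X r) (leg1 C X r) p q"
  note pD = pullbackD[OF pq]
  have "related C X r (leg1 C X r \<cdot> p) (leg2 C X r \<cdot> p)"
    using related_comp[OF X r related_legs[OF X r], of p] pD(4,7) rD by simp
  moreover have "related C X r (leg2 C X r \<cdot> p) (leg2 C X r \<cdot> q)"
    using related_comp[OF X r related_legs[OF X r], of q] pD rD by auto
  ultimately have "related C X r (leg1 C X r \<cdot> p) (leg2 C X r \<cdot> q)" by (rule trans)
  then show "\<exists>\<tau> \<in> hom C (Dom C p) (Dom C r). leg1 C X r \<cdot> \<tau> = leg1 C X r \<cdot> p \<and>
      leg2 C X r \<cdot> \<tau> = leg2 C X r \<cdot> q"
    unfolding related_def using pD rD by auto
qed

lemma related_kernel_pair: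
  assumes X: "X \<in> Obj C" and r: "relation C X r"
    and k: "is_kernel_pair C f (leg1 C X r) (leg2 C X r)"
  shows "related C X r x y \<longleftrightarrow> (\<exists>T. x \<in> hom C T X \<and> y \<in> hom C T X) \<and> f \<cdot> x = f \<cdot> y"
proof
  note rD = relation_simps[OF X r] and pb = k[unfolded is_kernel_pair_def]
  note pD = pullbackD[OF pb]
  show "(\<exists>T. x \<in> hom C T X \<and> y \<in> hom C T X) \<and> f \<cdot> x = f \<cdot> y" if xy: "related C X r x y"
  proof -
    obtain h where h: "h \<in> hom C (Dom C x) (Dom C r)" "leg1 C X r \<cdot> h = x" "leg2 C X r \<cdot> h = y"
      using xy unfolding related_def by blast
    have "f \<cdot> (leg1 C X r \<cdot> h) = f \<cdot> (leg2 C X r \<cdot> h)"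
      by (rule square_whisker[OF pD(9)]) (use h pD rD in simp_all)
    then show ?thesis using h relatedD[OF X r xy] by simp
  qed
  show "related C X r x y" if "(\<exists>T. x \<in> hom C T X \<and> y \<in> hom C T X) \<and> f \<cdot> x = f \<cdot> y"
  proof -
    have "Dom C f = X" using pD rD by simp
    then have "\<exists>!h. h \<in> hom C (Dom C x) (Dom C r) \<and> leg1 C X r \<cdot> h = x \<and> leg2 C X r \<cdot> h = y"
      using pullback_universal[OF pb, of x "Dom C x" y] that rD(5) by simp
    then show ?thesis unfolding related_def by blast
  qed
qed

lemma kernel_pair_relation_exists:
  assumes f: "f \<in> Arr C" "Dom C f = X"
  shows "\<exists>r. relation C X r \<and> is_kernel_pair C f (leg1 C X r) (leg2 C X r)"
proof -
  have X: "X \<in> Obj C" using f Dom_Obj by blast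
  obtain p q where pq: "is_pullback C f f p q" using pullback_exists[OF complete] f by blast
  note pD = pullbackD[OF pq]
  have "u = v" if "u \<in> hom C T (Dom C p)" "v \<in> hom C T (Dom C p)" "p \<cdot> u = p \<cdot> v" "q \<cdot> u = q \<cdot> v" for T u v
  proof -
    have "f \<cdot> (p \<cdot> v) = f \<cdot> (q \<cdot> v)"
      by (rule square_whisker[OF pD(9)]) (use that pD in simp_all)
    then show ?thesis
      using pullback_universal[OF pq, of "p \<cdot> v" T "q \<cdot> v"] that pD by auto
  qed
  then have "relation C X (pairing C X p q)" "leg1 C X (pairing C X p q) = p" "leg2 C X (pairing C X p q) = q"
    using jointly_monic_relation[OF X, of p "Dom C p" q] pD f by auto
  then show ?thesis using pq unfolding is_kernel_pair_def by metis
qed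

lemma kernel_pair_equivalence_relation:
  assumes X: "X \<in> Obj C" and r: "relation C X r"
    and k: "is_kernel_pair C f (leg1 C X r) (leg2 C X r)"
  shows "equivalence_relation C X r"
  by (rule equivalence_relationI[OF X r]) (auto simp: related_kernel_pair[OF X r k])


section \<open>Covers, images and composites\<close>

text \<open>Regular epimorphisms act as covers, by their stability under pullback: a generalised element
  of the codomain of one lifts to its domain after restriction along another.\<close>

lemma lift_along_regular_epi:
  assumes e: "regular_epi C e" and h: "h \<in> Arr C" "Cod C h = Cod C e"
  obtains c k where "regular_epi C c" "Cod C c = Dom C h" "k \<in> hom C (Dom C c) (Dom C e)"
    "e \<cdot> k = h \<cdot> c"
proof -
  obtain p q where pq: "is_pullback C e h p q"
    using pullback_exists[OF complete] regular_epi_arr[OF e] h by metis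
  then have "regular_epi C q" using regular e unfolding regular_category_def by blast
  then show ?thesis using pullbackD[OF pq] by (intro that[of q p]) auto
qed

text \<open>Membership in a relation is local, because regular epimorphisms are orthogonal to
  monomorphisms.\<close>

lemma related_descent:
  assumes X: "X \<in> Obj C" and r: "relation C X r" and e: "regular_epi C e"
    and x: "x \<in> hom C (Cod C e) X" and y: "y \<in> hom C (Cod C e) X"
    and rel: "related C X r (x \<cdot> e) (y \<cdot> e)"
  shows "related C X r x y"
proof -
  note rD = relation_simps[OF X r]
  note eA = regular_epi_arr[OF e]
  obtain a b where co: "is_coequaliser C a b e" using e unfolding regular_epi_def by blast
  note cD = coequaliserD[OF co]
  obtain k where k: "k \<in> hom C (Dom C e) (Dom C r)" "leg1 C X r \<cdot> k = x \<cdot> e" "leg2 C X r \<cdot> k = y \<cdot> e"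
    using rel x eA unfolding related_def by auto
  have fork: "(z \<cdot> e) \<cdot> a = (z \<cdot> e) \<cdot> b" if "z \<in> hom C (Cod C e) X" for z
    using that cD by (simp add: assoc)
  have "k \<cdot> a = k \<cdot> b"
  proof (rule legs_jointly_monic[OF X r, of _ "Dom C a"])
    show "leg1 C X r \<cdot> (k \<cdot> a) = leg1 C X r \<cdot> (k \<cdot> b)"
      using fork[OF x] k cD rD by (simp add: assoc[symmetric])
    show "leg2 C X r \<cdot> (k \<cdot> a) = leg2 C X r \<cdot> (k \<cdot> b)"
      using fork[OF y] k cD rD by (simp add: assoc[symmetric])
  qed (use k cD in auto)
  then obtain l where l: "l \<in> hom C (Cod C e) (Dom C r)" "l \<cdot> e = k"
    using coequaliser_factor[OF co, of k] k by auto
  have "leg1 C X r \<cdot> l = x"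
    by (rule regular_epi_epic[OF e, of _ X])
      (use l k x rD eA in \<open>auto simp: assoc\<close>)
  moreover have "leg2 C X r \<cdot> l = y"
    by (rule regular_epi_epic[OF e, of _ X])
      (use l k y rD eA in \<open>auto simp: assoc\<close>)
  ultimately show ?thesis using l x unfolding related_def by auto
qed

text \<open>The image is the quotient by the kernel pair: two elements of the quotient lift, after
  passing to a cover, to elements of the domain, and if these have the same value under \<open>f\<close> the
  quotient map identifies them.\<close>

lemma image_factorisation:
  assumes f: "f \<in> Arr C"
  obtains e m where "regular_epi C e" "monic C m" "e \<in> hom C (Dom C f) (Dom C m)"
    "Cod C m = Cod C f" "m \<cdot> e = f"
proof -
  obtain p q where pq: "is_pullback C f f p q" using pullback_exists[OF complete] f by blast
  note pD = pullbackD[OF pq]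
  obtain e where co: "is_coequaliser C p q e"
    using regular pq unfolding regular_category_def is_kernel_pair_def by blast
  note cD = coequaliserD[OF co]
  obtain m where m: "m \<in> hom C (Cod C e) (Cod C f)" "m \<cdot> e = f"
    using coequaliser_factor[OF co f] pD cD by auto
  have e: "regular_epi C e" using co unfolding regular_epi_def by blast
  have "a = b" if a: "a \<in> hom C T (Dom C m)" and b: "b \<in> hom C T (Dom C m)" and ab: "m \<cdot> a = m \<cdot> b" for T a b
  proof -
    obtain c1 a' where c1: "regular_epi C c1" "Cod C c1 = T" and
      a': "a' \<in> hom C (Dom C c1) (Dom C e)" "e \<cdot> a' = a \<cdot> c1"
      using lift_along_regular_epi[OF e, of a] a m by auto
    note c1A = regular_epi_arr[OF c1(1)]
    obtain c2 b' where c2: "regular_epi C c2" "Cod C c2 = Dom C c1" and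
      b': "b' \<in> hom C (Dom C c2) (Dom C e)" "e \<cdot> b' = (b \<cdot> c1) \<cdot> c2"
      using lift_along_regular_epi[OF e, of "b \<cdot> c1"] b m c1 c1A by auto
    note c2A = regular_epi_arr[OF c2(1)]
    have ea: "e \<cdot> (a' \<cdot> c2) = (a \<cdot> c1) \<cdot> c2"
      using a' c2 c2A cD by (simp add: assoc[symmetric])
    have "f \<cdot> (a' \<cdot> c2) = m \<cdot> (e \<cdot> (a' \<cdot> c2))"
      unfolding m(2)[symmetric] using a' c2 c2A cD m by (intro assoc) auto
    also have "\<dots> = (m \<cdot> a) \<cdot> (c1 \<cdot> c2)"
      unfolding ea using a c1 c1A c2 c2A m by (simp add: assoc)
    also have "\<dots> = m \<cdot> (e \<cdot> b')"
      unfolding ab b'(2) using b c1 c1A c2 c2A m by (simp add: assoc)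
    also have "\<dots> = f \<cdot> b'"
      unfolding m(2)[symmetric] using b' cD m by (intro assoc[symmetric]) auto
    finally have "f \<cdot> (a' \<cdot> c2) = f \<cdot> b'" .
    then obtain h where h: "h \<in> hom C (Dom C c2) (Dom C p)" "p \<cdot> h = a' \<cdot> c2" "q \<cdot> h = b'"
      using pullback_universal[OF pq, of "a' \<cdot> c2" "Dom C c2" b'] a' b' c2 c2A cD pD by auto
    have "e \<cdot> (p \<cdot> h) = e \<cdot> (q \<cdot> h)"
      by (rule square_whisker[OF cD(7)]) (use h cD in simp_all)
    then have "(a \<cdot> c1) \<cdot> c2 = (b \<cdot> c1) \<cdot> c2" using h ea b' by simp
    then have "a \<cdot> c1 = b \<cdot> c1"
      using regular_epi_epic[OF c2(1), of "a \<cdot> c1" "Dom C m" "b \<cdot> c1"] a b c1 c1A c2 by simp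
    then show "a = b"
      using regular_epi_epic[OF c1(1), of a "Dom C m" b] a b c1 by simp
  qed
  moreover have "m \<in> Arr C" using m by simp
  ultimately have "monic C m" unfolding monic_def by blast
  then show ?thesis using e cD pD m by (intro that[of e m]) auto
qed

lemma rel_comp_is_rel_comp:
  assumes X: "X \<in> Obj C" and r: "relation C X r" and s: "relation C X s"
  shows "is_rel_comp C X r s (rel_comp C X r s)"
proof -
  note rD = relation_simps[OF X r] and sD = relation_simps[OF X s]
  obtain p q where pq: "is_pullback C (leg2 C X s) (leg1 C X r) p q"
    using pullback_exists[OF complete] rD sD by metis
  note pD = pullbackD[OF pq]
  let ?w = "pairing C X (leg1 C X s \<cdot> p) (leg2 C X r \<cdot> q)"
  have w: "?w \<in> hom C (Dom C p) (square C X)"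
    by (rule pairing[OF X]) (use pD rD sD in auto)
  obtain e m where em: "regular_epi C e" "monic C m" "e \<in> hom C (Dom C ?w) (Dom C m)"
    "Cod C m = Cod C ?w" "m \<cdot> e = ?w"
    using w by (auto intro: image_factorisation[of ?w])
  have "is_rel_comp C X r s m"
    unfolding is_rel_comp_def
  proof (intro conjI exI)
    show "relation C X m" using em w by (simp add: relation_def)
  qed (use em w pq in auto)
  then show ?thesis unfolding rel_comp_def by (rule someI)
qed

lemma rel_comp_relation:
  "\<lbrakk>X \<in> Obj C; relation C X r; relation C X s\<rbrakk> \<Longrightarrow> relation C X (rel_comp C X r s)"
  using rel_comp_is_rel_comp unfolding is_rel_comp_def by blast

lemma related_rel_compI:
  assumes X: "X \<in> Obj C" and r: "relation C X r" and s: "relation C X s"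
    and xy: "related C X s x y" and yz: "related C X r y z"
  shows "related C X (rel_comp C X r s) x z"
proof -
  note rD = relation_simps[OF X r] and sD = relation_simps[OF X s]
  let ?t = "rel_comp C X r s"
  have t: "relation C X ?t" by (rule rel_comp_relation[OF X r s])
  note tD = relation_simps[OF X t]
  obtain p q e where pq: "is_pullback C (leg2 C X s) (leg1 C X r) p q"
    and e: "e \<in> hom C (Dom C p) (Dom C ?t)"
    and te: "?t \<cdot> e = pairing C X (leg1 C X s \<cdot> p) (leg2 C X r \<cdot> q)"
    using rel_comp_is_rel_comp[OF X r s] unfolding is_rel_comp_def by blast
  note pD = pullbackD[OF pq]
  have pair: "pr1 C X \<cdot> (?t \<cdot> e) = leg1 C X s \<cdot> p" "pr2 C X \<cdot> (?t \<cdot> e) = leg2 C X r \<cdot> q"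
    using pairing(2,3)[OF X, of "leg1 C X s \<cdot> p" "Dom C p" "leg2 C X r \<cdot> q"] pD rD sD
    unfolding te by auto
  obtain h where h: "h \<in> hom C (Dom C x) (Dom C s)" "leg1 C X s \<cdot> h = x" "leg2 C X s \<cdot> h = y"
    using xy unfolding related_def by blast
  obtain k where k: "k \<in> hom C (Dom C x) (Dom C r)" "leg1 C X r \<cdot> k = y" "leg2 C X r \<cdot> k = z"
    using yz relatedD(3)[OF X s xy] unfolding related_def by auto
  obtain u where u: "u \<in> hom C (Dom C x) (Dom C p)" "p \<cdot> u = h" "q \<cdot> u = k"
    using pullback_universal[OF pq, of h "Dom C x" k] h k rD sD by auto
  have "leg1 C X ?t \<cdot> (e \<cdot> u) = x"
    using leg_comp(1)[OF X tD(1,2), of e] pair e u h pD sD tD by (simp add: assoc assoc[symmetric, of u e "leg1 C X ?t"])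
  moreover have "leg2 C X ?t \<cdot> (e \<cdot> u) = z"
    using leg_comp(2)[OF X tD(1,2), of e] pair e u k pD rD tD by (simp add: assoc assoc[symmetric, of u e "leg2 C X ?t"])
  ultimately show ?thesis unfolding related_def using e u by (intro bexI[of _ "e \<cdot> u"]) auto
qed

text \<open>The middle element of a composite exists only after passing to a cover. By descent this is
  harmless when the goal is itself membership in a relation, so the elimination rule is stated
  for such goals.\<close>

lemma related_rel_compE:
  assumes X: "X \<in> Obj C" and r: "relation C X r" and s: "relation C X s"
    and xz: "related C X (rel_comp C X r s) x z"
    and g: "relation C X g" "x' \<in> hom C (Dom C x) X" "z' \<in> hom C (Dom C x) X"
    and step: "\<And>c y. \<lbrakk>c \<in> Arr C; Cod C c = Dom C x; related C X s (x \<cdot> c) y; related C X r y (z \<cdot> c)\<rbrakk>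
      \<Longrightarrow> related C X g (x' \<cdot> c) (z' \<cdot> c)"
  shows "related C X g x' z'"
proof -
  note rD = relation_simps[OF X r] and sD = relation_simps[OF X s]
  let ?t = "rel_comp C X r s"
  have t: "relation C X ?t" by (rule rel_comp_relation[OF X r s])
  note tD = relation_simps[OF X t]
  obtain p q e where pq: "is_pullback C (leg2 C X s) (leg1 C X r) p q"
    and re: "regular_epi C e" and e: "e \<in> hom C (Dom C p) (Dom C ?t)"
    and te: "?t \<cdot> e = pairing C X (leg1 C X s \<cdot> p) (leg2 C X r \<cdot> q)"
    using rel_comp_is_rel_comp[OF X r s] unfolding is_rel_comp_def by blast
  note pD = pullbackD[OF pq]
  have pair: "leg1 C X ?t \<cdot> e = leg1 C X s \<cdot> p" "leg2 C X ?t \<cdot> e = leg2 C X r \<cdot> q"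
    using leg_comp[OF X tD(1,2), of e] e pairing[OF X, of "leg1 C X s \<cdot> p" "Dom C p" "leg2 C X r \<cdot> q"]
      pD rD sD unfolding te by auto
  obtain h where h: "h \<in> hom C (Dom C x) (Dom C ?t)" "leg1 C X ?t \<cdot> h = x" "leg2 C X ?t \<cdot> h = z"
    using xz unfolding related_def by blast
  obtain c k where c: "regular_epi C c" "Cod C c = Dom C x"
    and k: "k \<in> hom C (Dom C c) (Dom C e)" "e \<cdot> k = h \<cdot> c"
    using lift_along_regular_epi[OF re, of h] h e by auto
  note cA = regular_epi_arr[OF c(1)]
  have "x \<cdot> c = leg1 C X s \<cdot> (p \<cdot> k)"
  proof -
    have "x \<cdot> c = leg1 C X ?t \<cdot> (e \<cdot> k)"
      using assoc[of c h "leg1 C X ?t"] h k(2) c cA tD by simp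
    also have "\<dots> = (leg1 C X ?t \<cdot> e) \<cdot> k" using e k tD by (simp add: assoc)
    also have "\<dots> = leg1 C X s \<cdot> (p \<cdot> k)" unfolding pair using k e pD sD by (simp add: assoc)
    finally show ?thesis .
  qed
  moreover have "z \<cdot> c = leg2 C X r \<cdot> (q \<cdot> k)"
  proof -
    have "z \<cdot> c = leg2 C X ?t \<cdot> (e \<cdot> k)"
      using assoc[of c h "leg2 C X ?t"] h k(2) c cA tD by simp
    also have "\<dots> = (leg2 C X ?t \<cdot> e) \<cdot> k" using e k tD by (simp add: assoc)
    also have "\<dots> = leg2 C X r \<cdot> (q \<cdot> k)" unfolding pair using k e pD rD by (simp add: assoc)
    finally show ?thesis .
  qed
  moreover have "leg2 C X s \<cdot> (p \<cdot> k) = leg1 C X r \<cdot> (q \<cdot> k)"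
    by (rule square_whisker[OF pD(9)]) (use k e pD rD sD in simp_all)
  moreover have "related C X s (leg1 C X s \<cdot> (p \<cdot> k)) (leg2 C X s \<cdot> (p \<cdot> k))"
    using related_comp[OF X s related_legs[OF X s]] pD k e sD by auto
  moreover have "related C X r (leg1 C X r \<cdot> (q \<cdot> k)) (leg2 C X r \<cdot> (q \<cdot> k))"
    using related_comp[OF X r related_legs[OF X r]] pD k e rD by auto
  ultimately have "related C X g (x' \<cdot> c) (z' \<cdot> c)"
    using step[OF cA c(2)] by simp
  then show ?thesis using related_descent[OF X g(1) c(1)] g c by simp
qed

lemma related_sandwichI:
  assumes X: "X \<in> Obj C" and r: "relation C X r" and s: "relation C X s"
    and "related C X r x a" "related C X s a b" "related C X r b z"
  shows "related C X (rel_comp C X r (rel_comp C X s r)) x z"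
  by (rule related_rel_compI[OF X r rel_comp_relation[OF X s r] related_rel_compI[OF X s r]]) fact+

lemma related_sandwichE:
  assumes X: "X \<in> Obj C" and r: "relation C X r" and s: "relation C X s"
    and xz: "related C X (rel_comp C X r (rel_comp C X s r)) x z"
    and g: "relation C X g" "x' \<in> hom C (Dom C x) X" "z' \<in> hom C (Dom C x) X"
    and step: "\<And>c a b. \<lbrakk>c \<in> Arr C; Cod C c = Dom C x; related C X r (x \<cdot> c) a; related C X s a b;
      related C X r b (z \<cdot> c)\<rbrakk> \<Longrightarrow> related C X g (x' \<cdot> c) (z' \<cdot> c)"
  shows "related C X g x' z'"
proof -
  note sr = rel_comp_relation[OF X s r]
  note xzD = relatedD[OF X rel_comp_relation[OF X r sr] xz]
  show ?thesis
  proof (rule related_rel_compE[OF X r sr xz g])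
    fix c y assume c: "c \<in> Arr C" "Cod C c = Dom C x"
      and xy: "related C X (rel_comp C X s r) (x \<cdot> c) y" and yz: "related C X r y (z \<cdot> c)"
    note yzD = relatedD[OF X r yz]
    have Dxc: "Dom C (x \<cdot> c) = Dom C c" "Dom C y = Dom C c" using c xzD yzD by simp_all
    show "related C X g (x' \<cdot> c) (z' \<cdot> c)"
    proof (rule related_rel_compE[OF X s r xy g(1)])
      fix d a assume d: "d \<in> Arr C" "Cod C d = Dom C (x \<cdot> c)"
        and xa: "related C X r ((x \<cdot> c) \<cdot> d) a" and ay: "related C X s a (y \<cdot> d)"
      have "related C X r (y \<cdot> d) ((z \<cdot> c) \<cdot> d)"
        by (rule related_comp[OF X r yz]) (use d Dxc in simp_all)
      then show "related C X g ((x' \<cdot> c) \<cdot> d) ((z' \<cdot> c) \<cdot> d)"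
        using step[of "c \<cdot> d" a "y \<cdot> d"] xa ay c d Dxc xzD g by (simp add: assoc)
    qed (use g c Dxc in simp_all)
  qed
qed

lemma coequaliser_related:
  assumes X: "X \<in> Obj C" and r: "relation C X r"
    and q: "is_coequaliser C (leg1 C X r) (leg2 C X r) q" and xy: "related C X r x y"
  shows "q \<cdot> x = q \<cdot> y"
proof -
  note rD = relation_simps[OF X r] and qD = coequaliserD[OF q]
  obtain h where h: "h \<in> hom C (Dom C x) (Dom C r)" "leg1 C X r \<cdot> h = x" "leg2 C X r \<cdot> h = y"
    using xy unfolding related_def by blast
  have "q \<cdot> (leg1 C X r \<cdot> h) = q \<cdot> (leg2 C X r \<cdot> h)"
    by (rule square_whisker[OF qD(7)]) (use h qD rD in simp_all)
  then show ?thesis using h by simp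
qed

end

section \<open>Joins of equivalence relations\<close>

locale exact = regular +
  assumes exact: "exact_category C"
begin

lemma quotient_exists:
  assumes X: "X \<in> Obj C" and r: "equivalence_relation C X r"
  obtains q where "is_coequaliser C (leg1 C X r) (leg2 C X r) q"
    "is_kernel_pair C q (leg1 C X r) (leg2 C X r)"
proof -
  have rel: "relation C X r" using r by (simp add: equivalence_relation_def)
  obtain f where f: "is_kernel_pair C f (leg1 C X r) (leg2 C X r)"
    using exact X r unfolding exact_category_def effective_def by blast
  note fpb = f[unfolded is_kernel_pair_def]
  note fD = pullbackD[OF fpb] and rD = relation_simps[OF X rel]
  obtain q where q: "is_coequaliser C (leg1 C X r) (leg2 C X r) q"
    using regular f unfolding regular_category_def by blast
  note qD = coequaliserD[OF q]
  obtain l where l: "l \<in> hom C (Cod C q) (Cod C f)" "l \<cdot> q = f"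
    using coequaliser_factor[OF q, of f] fD qD by auto
  \<comment> \<open>\<open>f\<close> factors through \<open>q\<close>, so \<open>q\<close> identifies no more than \<open>f\<close> does.\<close>
  have "is_kernel_pair C q (leg1 C X r) (leg2 C X r)"
    unfolding is_kernel_pair_def is_pullback_def
  proof (intro conjI bexI[of _ "Dom C r"] allI impI)
    fix T a b assume ab: "a \<in> hom C T (Dom C q) \<and> b \<in> hom C T (Dom C q) \<and> q \<cdot> a = q \<cdot> b"
    have "f \<cdot> z = l \<cdot> (q \<cdot> z)" if "z \<in> hom C T (Dom C q)" for z
      unfolding l(2)[symmetric] by (rule assoc) (use that l qD in simp_all)
    then have "f \<cdot> a = f \<cdot> b" using ab by simp
    moreover have "Dom C f = Dom C q" using fD qD by simp
    ultimately show "\<exists>!h. h \<in> hom C T (Dom C r) \<and> leg1 C X r \<cdot> h = a \<and> leg2 C X r \<cdot> h = b"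
      using pullback_universal[OF fpb, of a T b] ab rD(5) by simp
  qed (use qD rD Dom_Obj[of r] in simp_all)
  with q that show ?thesis by blast
qed

lemma equivalence_relation_elements:
  assumes X: "X \<in> Obj C" and r: "equivalence_relation C X r"
  shows "\<lbrakk>x \<in> Arr C; Cod C x = X\<rbrakk> \<Longrightarrow> related C X r x x"
    and "related C X r x y \<Longrightarrow> related C X r y x"
    and "\<lbrakk>related C X r x y; related C X r y z\<rbrakk> \<Longrightarrow> related C X r x z"
proof -
  have rel: "relation C X r" using r by (simp add: equivalence_relation_def)
  obtain q where "is_kernel_pair C q (leg1 C X r) (leg2 C X r)"
    using quotient_exists[OF X r] by blast
  note k = related_kernel_pair[OF X rel this]
  show "\<lbrakk>x \<in> Arr C; Cod C x = X\<rbrakk> \<Longrightarrow> related C X r x x"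
    "related C X r x y \<Longrightarrow> related C X r y x"
    "\<lbrakk>related C X r x y; related C X r y z\<rbrakk> \<Longrightarrow> related C X r x z"
    unfolding k by auto
qed

text \<open>The Goursat identity is exactly what transitivity of \<open>R \<circ> S \<circ> R\<close> needs: in
  \<open>x R a S b R y R a' S b' R z\<close> the two middle \<open>R\<close>-steps merge, the stretch from \<open>a\<close> to \<open>b'\<close> lies
  in \<open>S \<circ> R \<circ> S = R \<circ> S \<circ> R\<close>, and the outer \<open>R\<close>-steps are absorbed.\<close>

lemma sandwich_equivalence_relation:
  assumes X: "X \<in> Obj C" and r: "equivalence_relation C X r" and s: "equivalence_relation C X s"
    and permute: "same_subobject C (rel_comp C X r (rel_comp C X s r)) (rel_comp C X s (rel_comp C X r s))"
  shows "equivalence_relation C X (rel_comp C X r (rel_comp C X s r))"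
proof -
  let ?t = "rel_comp C X r (rel_comp C X s r)"
  have rr: "relation C X r" and ss: "relation C X s"
    using r s by (auto simp: equivalence_relation_def)
  have t: "relation C X ?t" by (intro rel_comp_relation X rr ss)
  have t': "relation C X (rel_comp C X s (rel_comp C X r s))" by (intro rel_comp_relation X rr ss)
  note R = equivalence_relation_elements[OF X r] and S = equivalence_relation_elements[OF X s]
  note tI = related_sandwichI[OF X rr ss] and tE = related_sandwichE[OF X rr ss]
  have absorb: "related C X ?t x w"
    if xy: "related C X r x y" and yz: "related C X ?t y z" and zw: "related C X r z w" for x y z w
  proof (rule tE[OF yz t])
    note D = relatedD[OF X rr xy] relatedD[OF X t yz] relatedD[OF X rr zw]
    show "x \<in> hom C (Dom C y) X" "w \<in> hom C (Dom C y) X" using D by simp_all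
    fix c a b assume c: "c \<in> Arr C" "Cod C c = Dom C y"
      and a: "related C X r (y \<cdot> c) a" and ab: "related C X s a b" and b: "related C X r b (z \<cdot> c)"
    have "related C X r (x \<cdot> c) (y \<cdot> c)" "related C X r (z \<cdot> c) (w \<cdot> c)"
      using related_comp[OF X rr xy, of c] related_comp[OF X rr zw, of c] c D by simp_all
    then show "related C X ?t (x \<cdot> c) (w \<cdot> c)" using tI[OF R(3)[OF _ a] ab R(3)[OF b]] by simp
  qed
  show ?thesis
  proof (rule equivalence_relationI[OF X t])
    fix x assume "x \<in> Arr C" "Cod C x = X"
    then show "related C X ?t x x" using tI[OF R(1) S(1) R(1)] by simp
  next
    fix x y assume xy: "related C X ?t x y"
    note D = relatedD[OF X t xy]
    show "related C X ?t y x"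
    proof (rule tE[OF xy t])
      show "y \<in> hom C (Dom C x) X" "x \<in> hom C (Dom C x) X" using D by simp_all
    qed (rule tI[OF R(2) S(2) R(2)])
  next
    fix x y z assume xy: "related C X ?t x y" and yz: "related C X ?t y z"
    note D = relatedD[OF X t xy] relatedD[OF X t yz]
    show "related C X ?t x z"
    proof (rule tE[OF xy t])
      show "x \<in> hom C (Dom C x) X" "z \<in> hom C (Dom C x) X" using D by simp_all
      fix c a b assume c: "c \<in> Arr C" "Cod C c = Dom C x"
        and a: "related C X r (x \<cdot> c) a" and ab: "related C X s a b" and b: "related C X r b (y \<cdot> c)"
      note D' = D relatedD[OF X rr a] relatedD[OF X ss ab] relatedD[OF X rr b]
      have yzc: "related C X ?t (y \<cdot> c) (z \<cdot> c)"
        by (rule related_comp[OF X t yz]) (use c D in simp_all)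
      show "related C X ?t (x \<cdot> c) (z \<cdot> c)"
      proof (rule tE[OF yzc t])
        show "x \<cdot> c \<in> hom C (Dom C (y \<cdot> c)) X" "z \<cdot> c \<in> hom C (Dom C (y \<cdot> c)) X"
          using c D by simp_all
        fix d a' b' assume d: "d \<in> Arr C" "Cod C d = Dom C (y \<cdot> c)"
          and a': "related C X r ((y \<cdot> c) \<cdot> d) a'" and ab': "related C X s a' b'"
          and b': "related C X r b' ((z \<cdot> c) \<cdot> d)"
        have d': "Cod C d = Dom C c" using c d D by simp
        have Dab: "Dom C a = Dom C c" "Dom C b = Dom C c" "Dom C (x \<cdot> c) = Dom C c"
          using c D' by simp_all
        have "related C X r ((x \<cdot> c) \<cdot> d) (a \<cdot> d)" "related C X s (a \<cdot> d) (b \<cdot> d)"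
          "related C X r (b \<cdot> d) ((y \<cdot> c) \<cdot> d)"
          using related_comp[OF X rr a d(1)] related_comp[OF X ss ab d(1)] related_comp[OF X rr b d(1)]
            d' Dab by simp_all
        moreover from this have "related C X (rel_comp C X s (rel_comp C X r s)) (a \<cdot> d) b'"
          using related_sandwichI[OF X ss rr _ R(3)[OF _ a'] ab'] by simp
        then have "related C X ?t (a \<cdot> d) b'"
          using related_mono[OF X t' t] permute unfolding same_subobject_def by blast
        ultimately show "related C X ?t ((x \<cdot> c) \<cdot> d) ((z \<cdot> c) \<cdot> d)"
          using absorb[OF _ _ b'] by simp
      qed
    qed
  qed
qed

end

section \<open>Birkhoff closure\<close>

locale birkhoff = exact +
  fixes L :: "'a set" and \<Lambda> :: "('a, 'b, 'a, 'b) cfun" and \<eta> :: "'a \<Rightarrow> 'b"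
  assumes birkhoff: "birkhoff_subcategory C L \<Lambda> \<eta>"
begin

lemma adjunction: "left_adjoint C (full_subcat C L) \<Lambda> inclusion \<eta>"
  using birkhoff unfolding birkhoff_subcategory_def epireflective_subcategory_def by blast

lemma unit_regular_epi: "A \<in> Obj C \<Longrightarrow> regular_epi C (\<eta> A)"
  using birkhoff unfolding birkhoff_subcategory_def epireflective_subcategory_def by blast

lemma unit_simps [simp]:
  assumes "A \<in> Obj C"
  shows "\<eta> A \<in> Arr C" "Dom C (\<eta> A) = A" "Cod C (\<eta> A) = FObj \<Lambda> A"
  using adjunction assms unfolding left_adjoint_def inclusion_def by auto

lemma reflection_in: "A \<in> Obj C \<Longrightarrow> FObj \<Lambda> A \<in> L"
  using adjunction unfolding left_adjoint_def is_functor_def by (auto simp: full_subcat_def)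

lemma unit_naturality:
  assumes f: "f \<in> hom C A B"
  shows "\<exists>g \<in> hom C (FObj \<Lambda> A) (FObj \<Lambda> B). g \<cdot> \<eta> A = \<eta> B \<cdot> f"
proof (intro bexI)
  have nat: "\<forall>f \<in> Arr C. FArr \<Lambda> f \<cdot> \<eta> (Dom C f) = \<eta> (Cod C f) \<cdot> f"
    and func: "is_functor C (full_subcat C L) \<Lambda>"
    using adjunction unfolding left_adjoint_def inclusion_def by simp_all
  show "FArr \<Lambda> f \<cdot> \<eta> A = \<eta> B \<cdot> f" using nat f by auto
  show "FArr \<Lambda> f \<in> hom C (FObj \<Lambda> A) (FObj \<Lambda> B)"
    using func f unfolding is_functor_def by (auto simp: full_subcat_def)
qed

lemma unit_universal:
  assumes "A \<in> Obj C" "B \<in> L" "f \<in> hom C A B"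
  shows "\<exists>g \<in> hom C (FObj \<Lambda> A) B. g \<cdot> \<eta> A = f"
proof -
  have "\<forall>A \<in> Obj C. \<forall>B \<in> Obj (full_subcat C L). \<forall>f \<in> hom C A B.
        \<exists>!g. g \<in> hom (full_subcat C L) (FObj \<Lambda> A) B \<and> g \<cdot> \<eta> A = f"
    using adjunction unfolding left_adjoint_def inclusion_def by simp
  moreover have "B \<in> Obj (full_subcat C L)" using assms by (simp add: full_subcat_def)
  ultimately obtain g where "g \<in> hom (full_subcat C L) (FObj \<Lambda> A) B" "g \<cdot> \<eta> A = f"
    using assms by blast
  then show ?thesis by (auto simp: full_subcat_def)
qed

lemma birkhoff_closureE:
  assumes X: "X \<in> Obj C" and ex: "\<exists>q. is_coequaliser C (leg1 C X s) (leg2 C X s) q"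
    and s: "Cod C (leg1 C X s) = X"
  obtains q where "relation C X (birkhoff_closure C \<eta> X s)"
    "is_coequaliser C (leg1 C X s) (leg2 C X s) q"
    "is_kernel_pair C (\<eta> (Cod C q) \<cdot> q)
       (leg1 C X (birkhoff_closure C \<eta> X s)) (leg2 C X (birkhoff_closure C \<eta> X s))"
proof -
  obtain q where q: "is_coequaliser C (leg1 C X s) (leg2 C X s) q" using ex by blast
  note qD = coequaliserD[OF q]
  have "\<eta> (Cod C q) \<cdot> q \<in> Arr C" "Dom C (\<eta> (Cod C q) \<cdot> q) = X"
    using qD s Cod_Obj[OF qD(3)] by simp_all
  then obtain t where "relation C X t" "is_kernel_pair C (\<eta> (Cod C q) \<cdot> q) (leg1 C X t) (leg2 C X t)"
    using kernel_pair_relation_exists by blast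
  with q have "is_birkhoff_closure C \<eta> X s t" unfolding is_birkhoff_closure_def by blast
  then have "is_birkhoff_closure C \<eta> X s (birkhoff_closure C \<eta> X s)"
    unfolding birkhoff_closure_def by (rule someI)
  then show ?thesis using that unfolding is_birkhoff_closure_def by blast
qed

text \<open>The coequaliser \<open>q\<close> of the two legs of the diagonal is invertible, so by naturality \<open>\<eta>\<close> at
  its codomain has, after composition with \<open>q\<close>, the same kernel as \<open>\<eta> X\<close>.\<close>

lemma birkhoff_closure_diag:
  assumes X: "X \<in> Obj C"
  shows "equivalence_relation C X (birkhoff_closure C \<eta> X (diag C X))"
    and "related C X (birkhoff_closure C \<eta> X (diag C X)) x y \<longleftrightarrow>
      (\<exists>T. x \<in> hom C T X \<and> y \<in> hom C T X) \<and> \<eta> X \<cdot> x = \<eta> X \<cdot> y"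
proof -
  let ?K = "birkhoff_closure C \<eta> X (diag C X)"
  have legs: "leg1 C X (diag C X) = Ident C X" "leg2 C X (diag C X) = Ident C X"
    using pairing[OF X, of "Ident C X" X "Ident C X"] X by (auto simp: leg1_def leg2_def diag_def)
  have "is_coequaliser C (Ident C X) (Ident C X) (Ident C X)"
    using X unfolding is_coequaliser_def by auto
  then obtain q where K: "relation C X ?K" and q: "is_coequaliser C (Ident C X) (Ident C X) q"
    and ker: "is_kernel_pair C (\<eta> (Cod C q) \<cdot> q) (leg1 C X ?K) (leg2 C X ?K)"
    using birkhoff_closureE[OF X, of "diag C X"] X unfolding legs by auto
  show "equivalence_relation C X ?K" by (rule kernel_pair_equivalence_relation[OF X K ker])
  note qD = coequaliserD[OF q]
  let ?Y = "Cod C q"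
  have Y: "?Y \<in> Obj C" using qD Cod_Obj by blast
  have q_hom: "q \<in> hom C X ?Y" using qD X by simp
  obtain g where g: "g \<in> hom C ?Y X" "g \<cdot> q = Ident C X"
    using coequaliser_factor[OF q, of "Ident C X"] X qD by auto
  obtain u where u: "u \<in> hom C (FObj \<Lambda> X) (FObj \<Lambda> ?Y)" "u \<cdot> \<eta> X = \<eta> ?Y \<cdot> q"
    using unit_naturality[OF q_hom] by blast
  obtain v where v: "v \<in> hom C (FObj \<Lambda> ?Y) (FObj \<Lambda> X)" "v \<cdot> \<eta> ?Y = \<eta> X \<cdot> g"
    using unit_naturality[OF g(1)] by blast
  have "v \<cdot> (\<eta> ?Y \<cdot> q) = (v \<cdot> \<eta> ?Y) \<cdot> q" using v(1) q_hom Y by (simp add: assoc)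
  also have "\<dots> = \<eta> X \<cdot> (g \<cdot> q)" unfolding v(2) using g(1) q_hom X by (simp add: assoc)
  finally have v': "v \<cdot> (\<eta> ?Y \<cdot> q) = \<eta> X" unfolding g(2) using X by simp
  have "(\<eta> ?Y \<cdot> q) \<cdot> x = (\<eta> ?Y \<cdot> q) \<cdot> y \<longleftrightarrow> \<eta> X \<cdot> x = \<eta> X \<cdot> y"
    if x: "x \<in> hom C T X" and y: "y \<in> hom C T X" for T
  proof
    assume "(\<eta> ?Y \<cdot> q) \<cdot> x = (\<eta> ?Y \<cdot> q) \<cdot> y"
    then have "v \<cdot> ((\<eta> ?Y \<cdot> q) \<cdot> x) = v \<cdot> ((\<eta> ?Y \<cdot> q) \<cdot> y)" by simp
    moreover have "v \<cdot> ((\<eta> ?Y \<cdot> q) \<cdot> z) = \<eta> X \<cdot> z" if "z \<in> hom C T X" for z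
      unfolding v'[symmetric] by (rule assoc[symmetric]) (use that v(1) q_hom Y in simp_all)
    ultimately show "\<eta> X \<cdot> x = \<eta> X \<cdot> y" using x y by simp
  next
    assume "\<eta> X \<cdot> x = \<eta> X \<cdot> y"
    then have "u \<cdot> (\<eta> X \<cdot> x) = u \<cdot> (\<eta> X \<cdot> y)" by simp
    moreover have "u \<cdot> (\<eta> X \<cdot> z) = (\<eta> ?Y \<cdot> q) \<cdot> z" if "z \<in> hom C T X" for z
      unfolding u(2)[symmetric] by (rule assoc[symmetric]) (use that u(1) X in simp_all)
    ultimately show "(\<eta> ?Y \<cdot> q) \<cdot> x = (\<eta> ?Y \<cdot> q) \<cdot> y" using x y by simp
  qed
  then show "related C X ?K x y \<longleftrightarrow>
      (\<exists>T. x \<in> hom C T X \<and> y \<in> hom C T X) \<and> \<eta> X \<cdot> x = \<eta> X \<cdot> y"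
    unfolding related_kernel_pair[OF X K ker] by blast
qed

text \<open>Write \<open>q : X \<rightarrow> X/S\<close> for the quotient. The kernel of \<open>\<eta> (X/S) \<cdot> q\<close> contains \<open>S\<close> and, by
  naturality, the kernel of \<open>\<eta> X\<close>; hence it contains the sandwich. For the converse, the quotient
  \<open>t : X \<rightarrow> X/T\<close> by the sandwich \<open>T\<close> identifies what \<open>\<eta> X\<close> identifies, so \<open>X/T\<close> is a regular quotient
  of \<open>\<Lambda> X\<close> and lies in \<open>L\<close>. As \<open>t\<close> also identifies the legs of \<open>S\<close>, it factors through \<open>q\<close>, and then
  through \<open>\<eta> (X/S) \<cdot> q\<close> because \<open>X/T\<close> is in \<open>L\<close>.\<close>

lemma birkhoff_closure_sandwich:
  assumes X: "X \<in> Obj C" and S: "equivalence_relation C X S"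
    and permute: "same_subobject C
      (rel_comp C X (birkhoff_closure C \<eta> X (diag C X)) (rel_comp C X S (birkhoff_closure C \<eta> X (diag C X))))
      (rel_comp C X S (rel_comp C X (birkhoff_closure C \<eta> X (diag C X)) S))"
  shows "same_subobject C (birkhoff_closure C \<eta> X S)
      (rel_comp C X (birkhoff_closure C \<eta> X (diag C X)) (rel_comp C X S (birkhoff_closure C \<eta> X (diag C X))))"
proof -
  let ?K = "birkhoff_closure C \<eta> X (diag C X)"
  let ?T = "rel_comp C X ?K (rel_comp C X S ?K)"
  let ?B = "birkhoff_closure C \<eta> X S"
  note K = birkhoff_closure_diag(1)[OF X] and inK = birkhoff_closure_diag(2)[OF X]
  have Krel: "relation C X ?K" and Srel: "relation C X S"
    using K S by (auto simp: equivalence_relation_def)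
  note SD = relation_simps[OF X Srel]
  have T: "equivalence_relation C X ?T" by (rule sandwich_equivalence_relation[OF X K S permute])
  then have Trel: "relation C X ?T" by (simp add: equivalence_relation_def)
  note TI = related_sandwichI[OF X Krel Srel]
  note reflK = equivalence_relation_elements(1)[OF X K] and reflS = equivalence_relation_elements(1)[OF X S]
  obtain q where B: "relation C X ?B" and q: "is_coequaliser C (leg1 C X S) (leg2 C X S) q"
    and kerB: "is_kernel_pair C (\<eta> (Cod C q) \<cdot> q) (leg1 C X ?B) (leg2 C X ?B)"
    using birkhoff_closureE[OF X, of S] quotient_exists[OF X S] SD by metis
  note inB = related_kernel_pair[OF X B kerB]
  note qD = coequaliserD[OF q]
  let ?Q = "Cod C q"
  have Q: "?Q \<in> Obj C" using qD Cod_Obj by blast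
  have q_hom: "q \<in> hom C X ?Q" using qD SD by simp
  obtain t where t: "is_coequaliser C (leg1 C X ?T) (leg2 C X ?T) t"
    and kerT: "is_kernel_pair C t (leg1 C X ?T) (leg2 C X ?T)"
    using quotient_exists[OF X T] by blast
  note inT = related_kernel_pair[OF X Trel kerT]
  have t_hom: "t \<in> hom C X (Cod C t)"
    using coequaliserD[OF t] relation_simps[OF X Trel] by simp
  obtain u where u: "u \<in> hom C (FObj \<Lambda> X) (FObj \<Lambda> ?Q)" "u \<cdot> \<eta> X = \<eta> ?Q \<cdot> q"
    using unit_naturality[OF q_hom] by blast

  have T_le_B: "related C X ?B x z" if xz: "related C X ?T x z" for x z
  proof (rule related_sandwichE[OF X Krel Srel xz B])
    note D = relatedD[OF X Trel xz]
    show "x \<in> hom C (Dom C x) X" "z \<in> hom C (Dom C x) X" using D by simp_all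
    fix c a b assume "related C X ?K (x \<cdot> c) a" "related C X S a b" "related C X ?K b (z \<cdot> c)"
    moreover have "related C X ?B v w" if vw: "related C X ?K v w" for v w
    proof -
      note vwD = relatedD[OF X Krel vw]
      have "\<eta> X \<cdot> v = \<eta> X \<cdot> w" using vw inK by blast
      moreover have "(\<eta> ?Q \<cdot> q) \<cdot> z = u \<cdot> (\<eta> X \<cdot> z)" if "z \<in> hom C (Dom C v) X" for z
        unfolding u(2)[symmetric] by (rule assoc) (use that u(1) X in simp_all)
      ultimately show ?thesis unfolding inB using vwD by auto
    qed
    moreover have "related C X ?B v w" if vw: "related C X S v w" for v w
    proof -
      note vwD = relatedD[OF X Srel vw]
      have "q \<cdot> v = q \<cdot> w" by (rule coequaliser_related[OF X Srel q vw])
      moreover have "(\<eta> ?Q \<cdot> q) \<cdot> z = \<eta> ?Q \<cdot> (q \<cdot> z)" if "z \<in> hom C (Dom C v) X" for z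
        by (rule assoc) (use that q_hom Q in simp_all)
      ultimately show ?thesis unfolding inB using vwD by auto
    qed
    moreover note trans = equivalence_relation_elements(3)[OF X kernel_pair_equivalence_relation[OF X B kerB]]
    ultimately show "related C X ?B (x \<cdot> c) (z \<cdot> c)" by (blast intro: trans)
  qed

  have B_le_T: "related C X ?T x z" if xz: "related C X ?B x z" for x z
  proof -
    obtain a b where ab: "is_coequaliser C a b (\<eta> X)"
      using unit_regular_epi[OF X] unfolding regular_epi_def by blast
    note abD = coequaliserD[OF ab]
    have "related C X ?K a b" unfolding inK using abD X by auto
    then have "related C X ?T a b" using TI[OF _ reflS reflK] abD X by simp
    then have "t \<cdot> a = t \<cdot> b" using inT by blast
    then obtain w where w: "w \<in> hom C (FObj \<Lambda> X) (Cod C t)" "w \<cdot> \<eta> X = t"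
      using coequaliser_factor[OF ab, of t] t_hom X by auto
    have "regular_epi C (w \<cdot> \<eta> X)" unfolding w(2) regular_epi_def using t by blast
    then have "regular_epi C w"
      using regular_epi_cancel[OF unit_regular_epi[OF X], of w] w X by simp
    moreover have "Dom C w \<in> L" using w reflection_in[OF X] by simp
    ultimately have "Cod C w \<in> L" using birkhoff unfolding birkhoff_subcategory_def by blast
    then have tL: "Cod C t \<in> L" using w by simp

    have "related C X ?T (leg1 C X S) (leg2 C X S)"
      using TI[OF reflK related_legs[OF X Srel] reflK] SD by simp
    then have "t \<cdot> leg1 C X S = t \<cdot> leg2 C X S" using inT by blast
    then obtain v where v: "v \<in> hom C ?Q (Cod C t)" "v \<cdot> q = t"
      using coequaliser_factor[OF q, of t] t_hom q_hom by auto
    obtain k where k: "k \<in> hom C (FObj \<Lambda> ?Q) (Cod C t)" "k \<cdot> \<eta> ?Q = v"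
      using unit_universal[OF Q tL v(1)] by blast
    have "k \<cdot> (\<eta> ?Q \<cdot> q) = (k \<cdot> \<eta> ?Q) \<cdot> q" using k(1) Q q_hom by (simp add: assoc)
    then have kt: "k \<cdot> (\<eta> ?Q \<cdot> q) = t" unfolding k(2) v(2) .
    note D = relatedD[OF X B xz]
    have "(\<eta> ?Q \<cdot> q) \<cdot> x = (\<eta> ?Q \<cdot> q) \<cdot> z" using xz inB by blast
    moreover have "t \<cdot> y = k \<cdot> ((\<eta> ?Q \<cdot> q) \<cdot> y)" if "y \<in> hom C (Dom C x) X" for y
      unfolding kt[symmetric] by (rule assoc) (use that k(1) Q q_hom in simp_all)
    ultimately show ?thesis unfolding inT using D by auto
  qed
  show ?thesis using T_le_B B_le_T by (intro same_subobjectI[OF X B Trel]) blast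
qed

end

theorem proposition3p7:
  fixes C :: "('o, 'm) cat" and L :: "'o set"
    and \<Lambda> :: "('o, 'm, 'o, 'm) cfun" and \<eta> :: "'o \<Rightarrow> 'm"
    and X :: 'o and S :: 'm
  assumes "exact_goursat_category C"
    and "birkhoff_subcategory C L \<Lambda> \<eta>"
    and "X \<in> Obj C"
    and "equivalence_relation C X S"
  shows "same_subobject C (birkhoff_closure C \<eta> X S)
           (rel_comp C X (birkhoff_closure C \<eta> X (diag C X))
              (rel_comp C X S (birkhoff_closure C \<eta> X (diag C X))))
       \<and> same_subobject C
           (rel_comp C X (birkhoff_closure C \<eta> X (diag C X))
              (rel_comp C X S (birkhoff_closure C \<eta> X (diag C X))))
           (rel_comp C X S (rel_comp C X (birkhoff_closure C \<eta> X (diag C X)) S))"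
proof -
  have ex: "exact_category C" and reg: "regular_category C" and cat: "category C"
    using assms(1)
    by (auto simp: exact_goursat_category_def exact_category_def regular_category_def)
  interpret birkhoff C L \<Lambda> \<eta>
    using cat reg ex assms(2)
    by (intro birkhoff.intro exact.intro regular.intro birkhoff_axioms.intro exact_axioms.intro
        regular_axioms.intro)
  have permute: "same_subobject C
      (rel_comp C X (birkhoff_closure C \<eta> X (diag C X)) (rel_comp C X S (birkhoff_closure C \<eta> X (diag C X))))
      (rel_comp C X S (rel_comp C X (birkhoff_closure C \<eta> X (diag C X)) S))"
    using assms(1,3,4) birkhoff_closure_diag(1)[OF assms(3)]
    unfolding exact_goursat_category_def by blast
  show ?thesis using birkhoff_closure_sandwich[OF assms(3,4) permute] permute by blast
qed

end
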